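(* Let $(P,\lambda)$ be a $(\mathbb{Z}_2)^n$-colored simple $n$-polytope with a sector $i:S\to P$, let $(\psi,\rho)$ be an isomorphism pair preserving $(S,\bar\lambda)$, let $v_0\in(\mathbb{Z}_2)^n$, and let $(P',\lambda')$ be a colored simple polytope obtained from $(P,\lambda)$ by $(\psi,\rho)$ at the sector $i$ (see context). If $\Psi(\psi,\rho,v_0)$ is extendable to $M_2$, then $M(\lambda)$ is homeomorphic to $M(\lambda')$.
   Context: Simple polytopes are simple convex polytopes embedded in $\mathbb{R}^n$; $\mathcal{F}(P)$ is the set of facets of $P$; $\mathrm{Aut}(S)$ is the group of self-homeomorphisms of the polytope $S$ as a manifold with corners (the induced permutation of $\mathcal{F}(S)$ is denoted by the same letter). A $(\mathbb{Z}_2)^n$-coloring on a simple $n$-polytope $P$ is a map $\lambda:\mathcal{F}(P)\to(\mathbb{Z}_2)^n$ such that whenever facets have nonempty common intersection their images are linearly independent. Put $M(\lambda)=P\times(\mathbb{Z}_2)^n/\sim$, with $\sim$ generated by $(p,v)\sim(p,v+\lambda(F))$ for $p\in F\in\mathcal{F}(P)$; let $\pi:M(\lambda)\to P$ be the projection. The class of $(p,v)$ is written $\{(p,v)\}$. Sector: for a simple $(n-1)$-polytope $S$, an embedding $i:S\to P$ is a sector if (a) $i(S)$ divides $P$ into two simple $n$-polytopes $P_1,P_2$ with $i(S)$ their common facet; (b) for every $k$-face $F\subset S$ there is a unique $(k+1)$-dimensional face $H$ of $P$ with $i(F)\subset H$ (in particular $i(S)$ contains no vertex of $P$). Then $i$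 induces $i_*:\mathcal{F}(S)\to\mathcal{F}(P)$, and $\bar\lambda=\lambda\circ i_*$ is the derived coloring. Let $i_r:S\to P_r$ ($r=1,2$) be induced by $i$, so $P=P_1\coprod P_2/i_1(s)\sim i_2(s)$. An isomorphism pair preserving $(S,\bar\lambda)$ is a pair $(\psi,\rho)$ with $\psi\in\mathrm{Aut}(S)$, $\rho\in \mathrm{GL}(n,\mathbb{Z}_2)$ and $\bar\lambda\circ\psi=\rho\circ\bar\lambda$. Construction of $(P',\lambda')$: $P'$ is a simple $n$-polytope with a sector $j:S\to P'$ cutting $P'$ into $P_1',P_2'$ (with induced embeddings $j_r:S\to P'_r$), for which there are combinatorial equivalences (homeomorphisms of manifolds with corners) $g_r:P_r\to P_r'$, $r=1,2$, with $g_1\circ i_1=j_1$ and $g_2\circ i_2\circ\psi=j_2$. For $F\in\mathcal{F}(P')$: if $F\cap P_1'\ne\emptyset$ let $F_1\in\mathcal{F}(P)$ be the unique facet of $P$ meeting $P_1$ with $g_1(F_1\cap P_1)\subset F$; if $F\cap P_2'\neq\emptyset$ let $F_2\in\mathcal{F}(P)$ be the unique facet of $P$ meeting $P_2$ with $g_2(F_2\cap P_2)\subset F$. Then $\lambda'(F)=\lambda(F_1)$ if $F\cap P_1'\ne\emptyset$ and $\lambda'(F)=\rho^{-1}(\lambda(F_2))$ if $F\cap P_2'\neq\emptyset$; this is a well-defined $(\mathbb{Z}_2)^n$-coloring on $P'$, and $M(\lambda')=P'\times(\mathbb{Z}_2)^n/\sim$, with $\sim$ generated by $(p,v)\sim(p,v+\lambda'(F))$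 for $p\in F\in\mathcal{F}(P')$. Sector manifold: $\mathcal{S}=S\times(\mathbb{Z}_2)^n/\sim$, with $\sim$ generated by $(s,v)\sim(s,v+\bar\lambda(f))$ for $s\in f\in\mathcal{F}(S)$; it is a closed $(n-1)$-manifold. Let $M_r=\pi^{-1}(P_r)$, a manifold with boundary, and $\iota_r:\mathcal{S}\hookrightarrow M_r$, $\{(s,v)\}\mapsto\{(i_r(s),v)\}$, so $\partial M_r=\iota_r(\mathcal{S})$ and $M(\lambda)=M_1\coprod M_2/\iota_1(x)\sim\iota_2(x)$. The homeomorphism $\Psi=\Psi(\psi,\rho,v_0):\mathcal{S}\to\mathcal{S}$ is $\{(s,v)\}\mapsto\{(\psi(s),\rho(v)+v_0)\}$. $\Psi(\psi,\rho,v_0)$ is extendable to $M_2$ if there is a self-homeomorphism $\widetilde\Psi:M_2\to M_2$ with $\widetilde\Psi\circ\iota_2=\iota_2\circ\Psi$. *)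

theory Defs
  imports "HOL-Analysis.Analysis" "HOL-Library.Z2"
begin

section \<open>Simple polytopes\<close>

definition simple_polytope :: "nat \<Rightarrow> 'a::euclidean_space set \<Rightarrow> bool" where
  "simple_polytope n P \<longleftrightarrow> polytope P \<and> aff_dim P = int n \<and>
     (\<forall>v. v extreme_point_of P \<longrightarrow> card {F. F facet_of P \<and> v \<in> F} = n)"

text \<open>A homeomorphism of manifolds with corners between polytopes is a homeomorphism that respects
  the stratification by faces in both directions.\<close>

definition corner_homeomorphism ::
  "'a::euclidean_space set \<Rightarrow> 'b::euclidean_space set \<Rightarrow> ('a \<Rightarrow> 'b) \<Rightarrow> bool" where
  "corner_homeomorphism P Q h \<longleftrightarrow>
     homeomorphic_map (top_of_set P) (top_of_set Q) h \<and>
     (\<forall>F. F \<subseteq> P \<longrightarrow> (h ` F face_of Q \<longleftrightarrow> F face_of P))"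

section \<open>Colorings\<close>

text \<open>The images of the facets in \<^term>\<open>\<G>\<close> are independent as a family, hence the injectivity
  clause.\<close>

definition coloring :: "'a::euclidean_space set \<Rightarrow> ('a set \<Rightarrow> bit ^ 'n) \<Rightarrow> bool" where
  "coloring P lam \<longleftrightarrow>
     (\<forall>\<G>. \<G> \<subseteq> {F. F facet_of P} \<and> \<Inter>\<G> \<noteq> {} \<longrightarrow>
        inj_on lam \<G> \<and> vec.independent (lam ` \<G>))"

section \<open>The quotient space of a colored polytope\<close>

definition quotient_topology :: "'a topology \<Rightarrow> ('a \<Rightarrow> 'b) \<Rightarrow> 'b topology" where
  "quotient_topology X q =
     topology (\<lambda>U. U \<subseteq> q ` topspace X \<and> openin X {x \<in> topspace X. q x \<in> U})"

lemma openin_quotient_topology: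
  fixes X :: "'a topology" and q :: "'a \<Rightarrow> 'b"
  shows "openin (quotient_topology X q) U \<longleftrightarrow>
     U \<subseteq> q ` topspace X \<and> openin X {x \<in> topspace X. q x \<in> U}"
proof -
  have "istopology (\<lambda>U. U \<subseteq> q ` topspace X \<and> openin X {x \<in> topspace X. q x \<in> U})"
    unfolding istopology_def
  proof (intro conjI allI impI)
    fix A B
    assume "A \<subseteq> q ` topspace X \<and> openin X {x \<in> topspace X. q x \<in> A}"
      and "B \<subseteq> q ` topspace X \<and> openin X {x \<in> topspace X. q x \<in> B}"
    moreover have "{x \<in> topspace X. q x \<in> A \<inter> B} =
        {x \<in> topspace X. q x \<in> A} \<inter> {x \<in> topspace X. q x \<in> B}" by blast
    ultimately show "openin X {x \<in> topspace X. q x \<in> A \<inter> B}" "A \<inter> B \<subseteq> q ` topspace X"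
      by (simp_all add: openin_Int le_infI1)
  next
    fix K :: "'b set set"
    assume K: "\<forall>U\<in>K. U \<subseteq> q ` topspace X \<and> openin X {x \<in> topspace X. q x \<in> U}"
    then show "\<Union>K \<subseteq> q ` topspace X" by blast
    have "{x \<in> topspace X. q x \<in> \<Union>K} = (\<Union>U\<in>K. {x \<in> topspace X. q x \<in> U})" by auto
    moreover have "openin X (\<Union>U\<in>K. {x \<in> topspace X. q x \<in> U})"
      using K by (intro openin_Union) auto
    ultimately show "openin X {x \<in> topspace X. q x \<in> \<Union>K}" by simp
  qed
  then show ?thesis by (simp add: quotient_topology_def)
qed

lemma topspace_quotient_topology: "topspace (quotient_topology X q) = q ` topspace X"
proof (rule antisym)
  show "topspace (quotient_topology X q) \<subseteq> q ` topspace X"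
    using openin_topspace[of "quotient_topology X q"]
    unfolding openin_quotient_topology by (rule conjunct1)
  have "{x \<in> topspace X. q x \<in> q ` topspace X} = topspace X" by auto
  then have "openin X {x \<in> topspace X. q x \<in> q ` topspace X}" using openin_topspace[of X] by metis
  then have "openin (quotient_topology X q) (q ` topspace X)"
    unfolding openin_quotient_topology by (intro conjI subset_refl)
  then show "q ` topspace X \<subseteq> topspace (quotient_topology X q)" by (rule openin_subset)
qed

lemma quotient_map_quotient_topology: "quotient_map X (quotient_topology X q) q"
  by (simp add: quotient_map_def topspace_quotient_topology openin_quotient_topology)

definition glue_rel ::
  "'a::euclidean_space set \<Rightarrow> ('a set \<Rightarrow> bit ^ 'n) \<Rightarrow> (('a \<times> (bit ^ 'n)) \<times> ('a \<times> (bit ^ 'n))) set" where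
  "glue_rel P lam =
     (let r = {((p, v), (p, v + lam F)) | p v F. F facet_of P \<and> p \<in> F} in (r \<union> r\<inverse>)\<^sup>*)"

definition glue_class ::
  "'a::euclidean_space set \<Rightarrow> ('a set \<Rightarrow> bit ^ 'n) \<Rightarrow> 'a \<times> (bit ^ 'n) \<Rightarrow> ('a \<times> (bit ^ 'n)) set" where
  "glue_class P lam x = glue_rel P lam `` {x}"

definition colored_manifold ::
  "'a::euclidean_space set \<Rightarrow> ('a set \<Rightarrow> bit ^ 'n) \<Rightarrow> ('a \<times> (bit ^ 'n)) set topology" where
  "colored_manifold P lam =
     quotient_topology (prod_topology (top_of_set P) (discrete_topology UNIV)) (glue_class P lam)"

text \<open>All elements of a class have the same first component.\<close>

definition proj :: "('a \<times> 'b) set \<Rightarrow> 'a" where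
  "proj c = the_elem (fst ` c)"

definition piece_manifold ::
  "'a::euclidean_space set \<Rightarrow> ('a set \<Rightarrow> bit ^ 'n) \<Rightarrow> 'a set \<Rightarrow> ('a \<times> (bit ^ 'n)) set topology" where
  "piece_manifold P lam Q =
     subtopology (colored_manifold P lam) {c \<in> topspace (colored_manifold P lam). proj c \<in> Q}"

section \<open>Sectors\<close>

text \<open>A face of dimension \<^term>\<open>k\<close> is nonempty here, whereas the library counts the empty set as a
  face (of affine dimension \<^term>\<open>-1\<close>).\<close>

definition sector ::
  "'b::euclidean_space set \<Rightarrow> (real ^ 'n) set \<Rightarrow> ('b \<Rightarrow> real ^ 'n) \<Rightarrow>
     (real ^ 'n) set \<Rightarrow> (real ^ 'n) set \<Rightarrow> bool" where
  "sector S P i P1 P2 \<longleftrightarrow>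
     simple_polytope (CARD('n) - 1) S \<and>
     embedding_map (top_of_set S) (top_of_set P) i \<and>
     simple_polytope CARD('n) P1 \<and> simple_polytope CARD('n) P2 \<and>
     P = P1 \<union> P2 \<and> P1 \<inter> P2 = i ` S \<and> i ` S facet_of P1 \<and> i ` S facet_of P2 \<and>
     (\<forall>F. F face_of S \<and> F \<noteq> {} \<longrightarrow>
        (\<exists>!H. H face_of P \<and> aff_dim H = aff_dim F + 1 \<and> i ` F \<subseteq> H))"

definition sector_facet ::
  "'a::euclidean_space set \<Rightarrow> ('b \<Rightarrow> 'a) \<Rightarrow> 'b set \<Rightarrow> 'a set" where
  "sector_facet P i f = (THE H. H facet_of P \<and> i ` f \<subseteq> H)"

definition derived_coloring ::
  "'a::euclidean_space set \<Rightarrow> ('b \<Rightarrow> 'a) \<Rightarrow> ('a set \<Rightarrow> bit ^ 'n) \<Rightarrow> 'b set \<Rightarrow> bit ^ 'n" where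
  "derived_coloring P i lam = lam \<circ> sector_facet P i"

definition isomorphism_pair ::
  "'b::euclidean_space set \<Rightarrow> ('b set \<Rightarrow> bit ^ 'n) \<Rightarrow> ('b \<Rightarrow> 'b) \<Rightarrow> bit ^ 'n ^ 'n \<Rightarrow> bool" where
  "isomorphism_pair S mu \<psi> \<rho> \<longleftrightarrow>
     corner_homeomorphism S S \<psi> \<and> invertible \<rho> \<and>
     (\<forall>f. f facet_of S \<longrightarrow> mu (\<psi> ` f) = \<rho> *v mu f)"

section \<open>Recutting along a sector\<close>

definition obtained_by ::
  "'b::euclidean_space set \<Rightarrow> (real ^ 'n) set \<Rightarrow> ((real ^ 'n) set \<Rightarrow> bit ^ 'n) \<Rightarrow>
     ('b \<Rightarrow> real ^ 'n) \<Rightarrow> (real ^ 'n) set \<Rightarrow> (real ^ 'n) set \<Rightarrow>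
     ('b \<Rightarrow> 'b) \<Rightarrow> bit ^ 'n ^ 'n \<Rightarrow>
     (real ^ 'n) set \<Rightarrow> ((real ^ 'n) set \<Rightarrow> bit ^ 'n) \<Rightarrow> bool" where
  "obtained_by S P lam i P1 P2 \<psi> \<rho> P' lam' \<longleftrightarrow>
     (\<exists>j P1' P2' g1 g2.
        sector S P' j P1' P2' \<and>
        corner_homeomorphism P1 P1' g1 \<and> corner_homeomorphism P2 P2' g2 \<and>
        (\<forall>s\<in>S. g1 (i s) = j s) \<and> (\<forall>s\<in>S. g2 (i (\<psi> s)) = j s) \<and>
        (\<forall>F. F facet_of P' \<and> F \<inter> P1' \<noteq> {} \<longrightarrow>
           lam' F = lam (THE F1. F1 facet_of P \<and> F1 \<inter> P1 \<noteq> {} \<and> g1 ` (F1 \<inter> P1) \<subseteq> F)) \<and>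
        (\<forall>F. F facet_of P' \<and> F \<inter> P2' \<noteq> {} \<longrightarrow>
           lam' F = matrix_inv \<rho> *v
             lam (THE F2. F2 facet_of P \<and> F2 \<inter> P2 \<noteq> {} \<and> g2 ` (F2 \<inter> P2) \<subseteq> F)))"

section \<open>The sector manifold and extendability\<close>

text \<open>The map on classes induced by \<^term>\<open>f\<close>: a class is sent to the \<^term>\<open>R\<close>-saturation of its
  image, which is a single class whenever \<^term>\<open>f\<close> is compatible with the relations
  (lemma \<open>induced_glue_class\<close>).\<close>

definition induced :: "('b \<times> 'b) set \<Rightarrow> ('a \<Rightarrow> 'b) \<Rightarrow> 'a set \<Rightarrow> 'b set" where
  "induced R f c = R `` (f ` c)"

definition sector_manifold ::
  "'b::euclidean_space set \<Rightarrow> 'a::euclidean_space set \<Rightarrow> ('a set \<Rightarrow> bit ^ 'n) \<Rightarrow> ('b \<Rightarrow> 'a) \<Rightarrow>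
     ('b \<times> (bit ^ 'n)) set topology" where
  "sector_manifold S P lam i = colored_manifold S (derived_coloring P i lam)"

definition sector_inclusion ::
  "'a::euclidean_space set \<Rightarrow> ('a set \<Rightarrow> bit ^ 'n) \<Rightarrow> ('b \<Rightarrow> 'a) \<Rightarrow>
     ('b \<times> (bit ^ 'n)) set \<Rightarrow> ('a \<times> (bit ^ 'n)) set" where
  "sector_inclusion P lam i = induced (glue_rel P lam) (\<lambda>(s, v). (i s, v))"

definition sector_map ::
  "'b::euclidean_space set \<Rightarrow> ('b set \<Rightarrow> bit ^ 'n) \<Rightarrow> ('b \<Rightarrow> 'b) \<Rightarrow> bit ^ 'n ^ 'n \<Rightarrow> bit ^ 'n \<Rightarrow>
     ('b \<times> (bit ^ 'n)) set \<Rightarrow> ('b \<times> (bit ^ 'n)) set" where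
  "sector_map S mu \<psi> \<rho> v0 = induced (glue_rel S mu) (\<lambda>(s, v). (\<psi> s, \<rho> *v v + v0))"

definition extendable ::
  "'b::euclidean_space set \<Rightarrow> 'a::euclidean_space set \<Rightarrow> ('a set \<Rightarrow> bit ^ 'n) \<Rightarrow> ('b \<Rightarrow> 'a) \<Rightarrow>
     'a set \<Rightarrow> ('b \<Rightarrow> 'b) \<Rightarrow> bit ^ 'n ^ 'n \<Rightarrow> bit ^ 'n \<Rightarrow> bool" where
  "extendable S P lam i P2 \<psi> \<rho> v0 \<longleftrightarrow>
     (\<exists>\<Phi>. homeomorphic_map (piece_manifold P lam P2) (piece_manifold P lam P2) \<Phi> \<and>
        (\<forall>x \<in> topspace (sector_manifold S P lam i).
           \<Phi> (sector_inclusion P lam i x) =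
           sector_inclusion P lam i (sector_map S (derived_coloring P i lam) \<psi> \<rho> v0 x)))"

lemma sym_glue_rel: "sym (glue_rel P lam)"
  unfolding glue_rel_def Let_def by (intro sym_rtrancl sym_Un_converse)

lemma trans_glue_rel: "trans (glue_rel P lam)"
  unfolding glue_rel_def Let_def by (rule trans_rtrancl)

lemma glue_rel_refl: "(x, x) \<in> glue_rel P lam"
  unfolding glue_rel_def Let_def by (rule rtrancl_refl)

lemma glue_rel_step: "F facet_of P \<Longrightarrow> p \<in> F \<Longrightarrow> ((p, v), (p, v + lam F)) \<in> glue_rel P lam"
  unfolding glue_rel_def Let_def by (rule r_into_rtrancl) blast

lemma glue_rel_induct [consumes 1, case_names refl step]:
  assumes "(x, y) \<in> glue_rel P lam"
    and refl: "\<And>x. R x x"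
    and step: "\<And>p v F. F facet_of P \<Longrightarrow> p \<in> F \<Longrightarrow> R (p, v) (p, v + lam F)"
    and sym: "\<And>x y. R x y \<Longrightarrow> R y x"
    and trans: "\<And>x y z. R x y \<Longrightarrow> R y z \<Longrightarrow> R x z"
  shows "R x y"
  using assms(1) unfolding glue_rel_def Let_def
proof (induction rule: rtrancl_induct)
  case base
  show ?case by (rule refl)
next
  case (step y z)
  from step.hyps(2) have "R y z"
  proof
    assume "(y, z) \<in> {((p, v), (p, v + lam F)) | p v F. F facet_of P \<and> p \<in> F}"
    then show ?thesis using assms(3) by blast
  next
    assume "(y, z) \<in> {((p, v), (p, v + lam F)) | p v F. F facet_of P \<and> p \<in> F}\<inverse>"
    then have "R z y" using assms(3) by blast
    then show ?thesis by (rule sym)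
  qed
  with step.IH show ?case by (rule trans)
qed

lemma proj_glue_class: "proj (glue_class P lam (p, v)) = p"
proof -
  have "fst x = fst y" if "(x, y) \<in> glue_rel P lam" for x y
    using that by (rule glue_rel_induct) auto
  then have "fst ` glue_class P lam (p, v) = {p}"
    using glue_rel_refl[of "(p, v)" P lam] by (force simp: glue_class_def)
  then show ?thesis by (simp add: proj_def)
qed

lemma induced_glue_class:
  assumes "\<And>p v F. F facet_of P \<Longrightarrow> p \<in> F \<Longrightarrow> (f (p, v), f (p, v + lam F)) \<in> glue_rel Q mu"
  shows "induced (glue_rel Q mu) f (glue_class P lam x) = glue_class Q mu (f x)"
proof -
  have f: "(f x, f y) \<in> glue_rel Q mu" if "(x, y) \<in> glue_rel P lam" for x y
    using that
    by (rule glue_rel_induct)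
       (use assms glue_rel_refl in \<open>blast intro: symD[OF sym_glue_rel] transD[OF trans_glue_rel]\<close>)+
  show ?thesis
  proof
    show "induced (glue_rel Q mu) f (glue_class P lam x) \<subseteq> glue_class Q mu (f x)"
      unfolding induced_def glue_class_def
      using f transD[OF trans_glue_rel[of Q mu]] by blast
    show "glue_class Q mu (f x) \<subseteq> induced (glue_rel Q mu) f (glue_class P lam x)"
      unfolding induced_def glue_class_def using glue_rel_refl[of x P lam] by blast
  qed
qed

lemma sector_facet:
  fixes P :: "(real ^ 'n) set"
  assumes "simple_polytope CARD('n) P" "sector S P i P1 P2" "f facet_of S"
  shows "sector_facet P i f facet_of P" "i ` f \<subseteq> sector_facet P i f"
proof -
  have n: "CARD('n) \<ge> 1" by (simp add: Suc_leI)
  have S: "aff_dim S = int (CARD('n) - 1)" and P: "aff_dim P = int CARD('n)"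
    using assms(1,2) unfolding sector_def simple_polytope_def by blast+
  have f: "f face_of S" "f \<noteq> {}" "aff_dim f + 1 = int CARD('n) - 1"
    using assms(3) S n by (auto simp: facet_of_def)
  have "H facet_of P \<longleftrightarrow> H face_of P \<and> aff_dim H = aff_dim f + 1" if "i ` f \<subseteq> H" for H
    using that f P by (auto simp: facet_of_def)
  moreover have "\<exists>!H. H face_of P \<and> aff_dim H = aff_dim f + 1 \<and> i ` f \<subseteq> H"
    using assms(2) f(1,2) unfolding sector_def by blast
  ultimately have "\<exists>!H. H facet_of P \<and> i ` f \<subseteq> H" by metis
  from theI'[OF this]
  show "sector_facet P i f facet_of P" "i ` f \<subseteq> sector_facet P i f"
    by (simp_all add: sector_facet_def)
qed

lemma sector_inclusion_glue_class:
  fixes P :: "(real ^ 'n) set"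
  assumes "simple_polytope CARD('n) P" "sector S P i P1 P2"
  shows "sector_inclusion P lam i (glue_class S (derived_coloring P i lam) (s, v)) =
    glue_class P lam (i s, v)"
proof -
  have "((i s, v), (i s, v + derived_coloring P i lam f)) \<in> glue_rel P lam"
    if "f facet_of S" "s \<in> f" for s v f
    using sector_facet[OF assms that(1)] that(2)
    by (auto simp: derived_coloring_def intro!: glue_rel_step)
  then show ?thesis
    unfolding sector_inclusion_def by (subst induced_glue_class) auto
qed

lemma corner_homeomorphism_face:
  assumes \<psi>: "corner_homeomorphism P Q \<psi>" and F: "F face_of P"
  shows "\<psi> ` F face_of Q" and "aff_dim (\<psi> ` F) = aff_dim F"
proof -
  have sub: "F \<subseteq> P" using F by (rule face_of_imp_subset)
  show face: "\<psi> ` F face_of Q" using \<psi> F sub by (simp add: corner_homeomorphism_def)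
  obtain \<phi> where "homeomorphic_maps (top_of_set P) (top_of_set Q) \<psi> \<phi>"
    using \<psi> unfolding corner_homeomorphism_def homeomorphic_map_maps by blast
  then have c: "continuous_on P \<psi>" "continuous_on Q \<phi>" "\<psi> ` P \<subseteq> Q"
    and inv: "\<And>x. x \<in> P \<Longrightarrow> \<phi> (\<psi> x) = x"
    by (auto simp: homeomorphic_maps_def)
  have \<phi>F: "\<phi> ` \<psi> ` F = F" using inv sub by force
  show "aff_dim (\<psi> ` F) = aff_dim F"
  proof (rule antisym)
    show "aff_dim F \<le> aff_dim (\<psi> ` F)"
    proof (rule invariance_of_dimension_convex_domain)
      show "convex F" using F by (rule face_of_imp_convex)
      show "continuous_on F \<psi>" using c(1) sub by (rule continuous_on_subset)
      show "\<psi> \<in> F \<rightarrow> affine hull \<psi> ` F" by (simp add: Pi_iff hull_inc)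
      show "inj_on \<psi> F" using inv sub by (metis inj_onI subsetD)
    qed
    show "aff_dim (\<psi> ` F) \<le> aff_dim F"
    proof (rule invariance_of_dimension_convex_domain)
      show "convex (\<psi> ` F)" using face by (rule face_of_imp_convex)
      show "continuous_on (\<psi> ` F) \<phi>"
        using c(2) face_of_imp_subset[OF face] by (rule continuous_on_subset)
      show "\<phi> \<in> \<psi> ` F \<rightarrow> affine hull F"
      proof
        fix y assume "y \<in> \<psi> ` F"
        then have "\<phi> y \<in> \<phi> ` \<psi> ` F" by (rule imageI)
        then show "\<phi> y \<in> affine hull F" unfolding \<phi>F by (rule hull_inc)
      qed
      show "inj_on \<phi> (\<psi> ` F)"
      proof (rule inj_on_inverseI)
        fix y assume "y \<in> \<psi> ` F"
        then obtain x where "x \<in> F" "y = \<psi> x" by blast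
        moreover from \<open>x \<in> F\<close> have "\<phi> (\<psi> x) = x" using inv sub by blast
        ultimately show "\<psi> (\<phi> y) = y" by simp
      qed
    qed
  qed
qed

lemma corner_homeomorphism_facet:
  assumes \<psi>: "corner_homeomorphism P Q \<psi>" and "convex P" and f: "f facet_of P"
  shows "\<psi> ` f facet_of Q"
proof -
  have "\<psi> ` P = Q"
    using \<psi> homeomorphic_imp_surjective_map unfolding corner_homeomorphism_def by fastforce
  then have "aff_dim Q = aff_dim P"
    using corner_homeomorphism_face(2)[OF \<psi> face_of_refl[OF \<open>convex P\<close>]] by simp
  then show ?thesis
    using corner_homeomorphism_face[OF \<psi>, of f] f by (auto simp: facet_of_def)
qed

lemma sector_map_glue_class:
  assumes "isomorphism_pair S mu \<psi> \<rho>" "convex S"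
  shows "sector_map S mu \<psi> \<rho> v0 (glue_class S mu (s, v)) = glue_class S mu (\<psi> s, \<rho> *v v + v0)"
proof -
  have "((\<psi> s, \<rho> *v v + v0), (\<psi> s, \<rho> *v (v + mu f) + v0)) \<in> glue_rel S mu"
    if f: "f facet_of S" "s \<in> f" for s v f
  proof -
    have "\<psi> ` f facet_of S" "mu (\<psi> ` f) = \<rho> *v mu f"
      using assms f corner_homeomorphism_facet by (auto simp: isomorphism_pair_def)
    then show ?thesis
      using glue_rel_step[of "\<psi> ` f" S "\<psi> s" "\<rho> *v v + v0" mu] f(2)
      by (simp add: matrix_vector_right_distrib add_ac)
  qed
  then show ?thesis
    unfolding sector_map_def by (subst induced_glue_class) auto
qed

end

theory Submission
  imports Defs
begin

text \<open>Write \<open>M(\<lambda>) = M\<^sub>1 \<union> M\<^sub>2\<close> and \<open>M(\<lambda>') = M\<^sub>1' \<union> M\<^sub>2'\<close>. The maps \<open>{(p, v)} \<mapsto> {(g\<^sub>1 p, v)}\<close> and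
  \<open>{(p, v)} \<mapsto> {(g\<^sub>2 p, \<rho>\<^sup>-\<^sup>1 (v - v\<^sub>0))}\<close> are homeomorphisms of the pieces, and the first one agrees on
  the common boundary with the second one precomposed with the extension of \<open>\<Psi>\<close> to \<open>M\<^sub>2\<close>, so the two
  paste together. They are well defined because the facets of \<open>P\<^sub>1\<close> other than the sector are exactly
  the nonempty traces of the facets of \<open>P\<close>, which holds since the sector contains no vertex of \<open>P\<close>.\<close>

section \<open>Cutting a polytope along a hyperplane\<close>

text \<open>On the sector the two explicit maps disagree exactly by \<open>\<Psi>\<close>, since
  \<open>P'\<close> is glued with the twist \<open>\<psi>\<close> while the first half is kept
  fixed. Extendability spreads this discrepancy over all of \<open>M\<^sub>2\<close>, where
  precomposition absorbs it. The linear part \<open>\<rho>\<^sup>-\<^sup>1\<close> of the second map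
  is forced by the colours on \<open>P2'\<close>, the shift by the translation part of
  \<open>\<Psi>\<close>.

  Why vertices on the sector would be fatal: the pieces carry the gluing relation of the whole
  polytope, not that of \<open>P1\<close> or \<open>P2\<close>. A facet of \<open>P\<close> touching
  \<open>P1\<close> only in a small set inside the cutting hyperplane would still identify points
  over that set, but \<open>g\<^sub>1\<close> respects only the faces of \<open>P1\<close> and need
  not send that set into a facet of \<open>P'\<close> with the same colour. The sector itself is a
  facet of both halves but is not glued, so it has to be kept apart from the traces.

  The hard part is thus to extract the absence of vertices from the uniqueness clause of
  \<open>sector\<close>. Everything after that is dimension counting for facets and descent along
  quotient maps.\<close>

lemma face_in_two_faces:
  fixes P :: "'a::euclidean_space set"
  assumes "polytope P" "C face_of P" "C \<noteq> {}" "aff_dim C + 2 \<le> aff_dim P"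
  obtains H1 H2 where "H1 face_of P" "H2 face_of P" "H1 \<noteq> H2" "C \<subseteq> H1" "C \<subseteq> H2"
    "aff_dim H1 = aff_dim C + 1" "aff_dim H2 = aff_dim C + 1"
proof -
  \<comment> \<open>A face of least dimension in this family has its facets outside the family, so
    its facets through \<open>C\<close> have dimension exactly \<open>aff_dim C + 1\<close>. There
    are at least two of them, because \<open>C\<close> is the intersection of the facets containing
    it and is smaller than each one.\<close>
  define \<K> where "\<K> = {K. K face_of P \<and> C \<subseteq> K \<and> aff_dim C + 2 \<le> aff_dim K}"
  have "finite \<K>"
    using finite_polytope_faces[OF assms(1)] by (rule rev_finite_subset) (auto simp: \<K>_def)
  moreover have "P \<in> \<K>"
    using assms face_of_imp_subset face_of_refl polytope_imp_convex by (auto simp: \<K>_def)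
  ultimately obtain K where K: "K \<in> \<K>" and min: "\<And>L. L \<in> \<K> \<Longrightarrow> aff_dim K \<le> aff_dim L"
    using ex_min_if_finite[of "aff_dim ` \<K>"]
    by (metis (no_types, lifting) empty_iff finite_imageI image_iff linorder_not_less)
  have KP: "K face_of P" "C \<subseteq> K" "aff_dim C + 2 \<le> aff_dim K" using K by (auto simp: \<K>_def)
  have poly: "polyhedron K"
    using KP(1) assms(1) face_of_polytope_polytope polytope_imp_polyhedron by blast
  have C: "C face_of K" "C \<noteq> K"
    using KP assms(2) face_of_face by auto
  have facets: "F face_of P \<and> aff_dim F = aff_dim C + 1" if F: "F facet_of K" "C \<subseteq> F" for F
  proof -
    have FP: "F face_of P" using F KP(1) facet_of_imp_face_of face_of_trans by blast
    have "aff_dim F = aff_dim K - 1" using F by (simp add: facet_of_def)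
    moreover have "F \<notin> \<K>" using min[of F] \<open>aff_dim F = aff_dim K - 1\<close> by auto
    ultimately show ?thesis using FP F(2) KP(3) by (auto simp: \<K>_def)
  qed
  have eq: "C = \<Inter>{F. F facet_of K \<and> C \<subseteq> F}"
    by (rule face_of_polyhedron[OF poly C(1) assms(3) C(2)])
  obtain F1 where F1: "F1 facet_of K" "C \<subseteq> F1"
    using face_of_polyhedron_subset_facet[OF poly C(1) assms(3) C(2)] by blast
  have "C \<noteq> F1" using facets[OF F1] by auto
  then obtain F2 where F2: "F2 facet_of K" "C \<subseteq> F2" "F2 \<noteq> F1"
    using eq F1 by blast
  show ?thesis using that[of F1 F2] facets F1 F2 by metis
qed

text \<open>The supporting hyperplanes of both parts along the common facet equal its affine hull,
  so one hyperplane serves both. A point of \<open>P2\<close> strictly on the side of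
  \<open>P1\<close> could be joined to an interior point of \<open>P1\<close> within that open
  half-space; by connectedness the segment would meet \<open>P1 \<inter> P2\<close>, which lies in
  the hyperplane. The interior point on the hyperplane later shows that it does not support the
  union.\<close>

lemma convex_union_split:
  fixes P1 P2 :: "'a::euclidean_space set"
  assumes "polytope P1" "polytope P2" "convex (P1 \<union> P2)"
    and dim: "aff_dim P1 = DIM('a)" "aff_dim P2 = DIM('a)"
    and facet: "(P1 \<inter> P2) facet_of P1" "(P1 \<inter> P2) facet_of P2"
  obtains a b where "a \<noteq> 0" "P1 = (P1 \<union> P2) \<inter> {x. a \<bullet> x \<le> b}"
    "P2 = (P1 \<union> P2) \<inter> {x. a \<bullet> x \<ge> b}" "\<exists>x \<in> interior (P1 \<union> P2). a \<bullet> x = b"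
proof -
  let ?H = "P1 \<inter> P2"
  obtain a b where a: "a \<noteq> 0" "P1 \<subseteq> {x. a \<bullet> x \<le> b}" "?H = P1 \<inter> {x. a \<bullet> x = b}"
    using facet_of_polyhedron[OF polytope_imp_polyhedron[OF assms(1)] facet(1)] .
  obtain a' b' where a': "a' \<noteq> 0" "P2 \<subseteq> {x. a' \<bullet> x \<le> b'}" "?H = P2 \<inter> {x. a' \<bullet> x = b'}"
    using facet_of_polyhedron[OF polytope_imp_polyhedron[OF assms(2)] facet(2)] .
  have Hdim: "aff_dim ?H = DIM('a) - 1" "?H \<noteq> {}" using facet(1) dim by (auto simp: facet_of_def)
  have hull: "affine hull ?H = {x. c \<bullet> x = d}" if "c \<noteq> 0" "?H \<subseteq> {x. c \<bullet> x = d}" for c d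
    using that Hdim
    by (intro affine_dim_equal) (auto simp: affine_hyperplane hull_minimal)
  have "{x. a \<bullet> x = b} = {x. a' \<bullet> x = b'}" using hull[of a b] hull[of a' b'] a a' by blast
  with a' have P2H: "?H = P2 \<inter> {x. a \<bullet> x = b}" by simp
  have int: "interior Q \<noteq> {}" if "polytope Q" "aff_dim Q = DIM('a)" for Q :: "'a set"
  proof -
    have "rel_interior Q = interior Q"
      using that(2) by (simp add: aff_dim_eq_full rel_interior_interior)
    then show ?thesis
      using that rel_interior_eq_empty[OF polytope_imp_convex[OF that(1)]] by auto
  qed
  obtain x where x: "x \<in> interior P1" using int[OF assms(1) dim(1)] by blast
  obtain y where y: "y \<in> interior P2" using int[OF assms(2) dim(2)] by blast
  have "interior P1 \<subseteq> {x. a \<bullet> x < b}"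
    using interior_mono[OF a(2)] a(1) by simp
  with x have xb: "a \<bullet> x < b" "x \<in> P1" using interior_subset by auto
  have P2ge: "a \<bullet> z > b" if z: "z \<in> P2" "z \<notin> ?H" for z
  proof (rule ccontr)
    assume "\<not> a \<bullet> z > b"
    then have zb: "a \<bullet> z < b" using z P2H by force
    have sub: "closed_segment x z \<subseteq> P1 \<union> P2"
      using xb z assms(3) by (simp add: closed_segment_subset)
    have "closed P1" "closed P2" using assms polytope_imp_closed by auto
    moreover have "connected (closed_segment x z)" by simp
    ultimately have "P1 \<inter> P2 \<inter> closed_segment x z \<noteq> {}"
      using sub xb z unfolding connected_closed by (metis Int_commute Int_iff empty_iff ends_in_segment)
    then obtain w where "w \<in> closed_segment x z" "w \<in> ?H" by blast
    moreover have "closed_segment x z \<subseteq> {x. a \<bullet> x < b}"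
      using zb xb by (intro closed_segment_subset) (auto simp: convex_halfspace_lt)
    ultimately show False using a(3) by auto
  qed
  then have P2sub: "P2 \<subseteq> {x. a \<bullet> x \<ge> b}" using a(3) by fastforce
  then have "interior P2 \<subseteq> {x. a \<bullet> x > b}"
    using interior_mono[OF P2sub] a(1) by simp
  with y have yb: "a \<bullet> y > b" by auto
  have "connected (interior (P1 \<union> P2))"
    using assms(3) convex_interior convex_connected by blast
  moreover have "x \<in> interior (P1 \<union> P2)" "y \<in> interior (P1 \<union> P2)"
    using x y interior_mono[of P1 "P1 \<union> P2"] interior_mono[of P2 "P1 \<union> P2"] by auto
  ultimately have "\<exists>z \<in> interior (P1 \<union> P2). a \<bullet> z = b"
    using xb yb by (intro connected_ivt_hyperplane[of _ x y]) auto
  moreover have "P1 = (P1 \<union> P2) \<inter> {x. a \<bullet> x \<le> b}" using a P2ge by fastforce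
  moreover have "P2 = (P1 \<union> P2) \<inter> {x. a \<bullet> x \<ge> b}" using a P2H P2sub by fastforce
  ultimately show ?thesis using that a(1) by metis
qed

text \<open>A face of least dimension through \<open>s\<close> works: were \<open>s\<close> on its
  relative frontier, one of its facets would be a smaller face through \<open>s\<close>.\<close>

lemma point_in_rel_interior_of_face:
  fixes S :: "'a::euclidean_space set"
  assumes "polytope S" "s \<in> S"
  obtains F where "F face_of S" "s \<in> rel_interior F"
proof -
  define \<K> where "\<K> = {K. K face_of S \<and> s \<in> K}"
  have "finite \<K>"
    using finite_polytope_faces[OF assms(1)] by (rule rev_finite_subset) (auto simp: \<K>_def)
  moreover have "S \<in> \<K>"
    using assms face_of_refl polytope_imp_convex by (auto simp: \<K>_def)
  ultimately obtain K where K: "K \<in> \<K>" and min: "\<And>L. L \<in> \<K> \<Longrightarrow> aff_dim K \<le> aff_dim L"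
    using ex_min_if_finite[of "aff_dim ` \<K>"]
    by (metis (no_types, lifting) empty_iff finite_imageI image_iff linorder_not_less)
  have KS: "K face_of S" "s \<in> K" using K by (auto simp: \<K>_def)
  have poly: "polytope K" using KS(1) assms(1) face_of_polytope_polytope by blast
  have "s \<in> rel_interior K"
  proof (rule ccontr)
    assume "s \<notin> rel_interior K"
    then have "s \<in> rel_frontier K" using KS(2) closure_subset by (auto simp: rel_frontier_def)
    then obtain F where F: "F facet_of K" "s \<in> F"
      using rel_frontier_of_polyhedron[OF polytope_imp_polyhedron[OF poly]] by auto
    then have "F \<in> \<K>"
      using face_of_trans[OF facet_of_imp_face_of[OF F(1)] KS(1)] by (simp add: \<K>_def)
    then show False using min[of F] F by (auto simp: facet_of_def)
  qed
  then show ?thesis using that KS(1) by blast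
qed

text \<open>Only the incidences of images of faces with faces of \<^term>\<open>P\<close> are known here: \<^term>\<open>i\<close> need
  not map faces of \<^term>\<open>S\<close> to faces of the slice, so invariance of domain replaces convexity. A face
  \<open>G\<close> of maximal dimension inside the hyperplane contains a relative interior point \<open>q = i s\<close>
  outside the images of all faces of smaller dimension (Baire). If \<open>s\<close> is in the relative interior of
  the face \<open>F\<close>, and \<open>H\<close> is the face of \<^term>\<open>P\<close> assigned to \<open>F\<close>, then \<open>q\<close> is interior to the slice
  of \<open>H\<close>. Either that slice meets the relative interior of \<open>H\<close>, which puts \<open>q\<close> there as well, or it
  is a face lying in two candidates for \<open>H\<close>.\<close>

lemma hyperplane_slice_no_face:
  fixes P :: "'a::euclidean_space set" and S :: "'b::euclidean_space set"
  assumes P: "polytope P" and S: "polytope S"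
    and meets: "r \<in> interior P" "a \<bullet> r = b" and a: "a \<noteq> 0"
    and i: "continuous_on S i" "inj_on i S" "i ` S = P \<inter> {x. a \<bullet> x = b}"
    and uniq: "\<And>F. F face_of S \<Longrightarrow> F \<noteq> {} \<Longrightarrow>
      \<exists>!H. H face_of P \<and> aff_dim H = aff_dim F + 1 \<and> i ` F \<subseteq> H"
    and G0: "G0 face_of P" "G0 \<subseteq> {x. a \<bullet> x = b}"
  shows "G0 = {}"
proof (rule ccontr)
  assume "G0 \<noteq> {}"
  let ?A = "{x. a \<bullet> x = b}"
  define \<K> where "\<K> = {K. K face_of P \<and> K \<noteq> {} \<and> K \<subseteq> ?A}"
  have convP: "convex P" using P polytope_imp_convex by blast
  have fin: "finite \<K>"
    using finite_polytope_faces[OF P] by (rule rev_finite_subset) (auto simp: \<K>_def)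
  have "G0 \<in> \<K>" using G0 \<open>G0 \<noteq> {}\<close> by (auto simp: \<K>_def)
  \<comment> \<open>Maximality is used twice: it keeps the larger face \<open>H\<close> from lying
    in the hyperplane, and it bounds the dimension of \<open>H \<inter> ?A\<close> once that slice
    is known to be a face.\<close>
  with fin obtain G where G: "G \<in> \<K>" and max: "\<And>L. L \<in> \<K> \<Longrightarrow> aff_dim L \<le> aff_dim G"
    using Max_in[of "aff_dim ` \<K>"] Max_ge[of "aff_dim ` \<K>"]
    by (metis (no_types, lifting) empty_iff finite_imageI image_iff)
  have GP: "G face_of P" "G \<noteq> {}" "G \<subseteq> ?A" using G by (auto simp: \<K>_def)
  have GS: "G \<subseteq> i ` S" using GP face_of_imp_subset i(3) by blast
  have convG: "convex G" using GP(1) face_of_imp_convex by blast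
  have closedG: "closed G" using GP(1) P face_of_polytope_polytope polytope_imp_closed by blast
  obtain i' where i': "\<And>x. x \<in> S \<Longrightarrow> i' (i x) = x" and cont_i': "continuous_on (i ` S) i'"
    using continuous_on_inv[OF i(1) polytope_imp_compact[OF S], of "the_inv_into S i"]
      the_inv_into_f_f[OF i(2)] by metis

  define \<G> where "\<G> = insert (rel_interior G) ((\<lambda>F. G - i ` F) ` {F. F face_of S \<and> aff_dim F < aff_dim G})"
  have "G \<subseteq> closure (\<Inter>\<G>)"
  proof (rule Baire[OF closedG])
    show "countable \<G>"
      unfolding \<G>_def using finite_polytope_faces[OF S] by (simp add: countable_finite)
  next
    fix T assume "T \<in> \<G>"
    then consider "T = rel_interior G" | F where "T = G - i ` F" "F face_of S" "aff_dim F < aff_dim G"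
      unfolding \<G>_def by blast
    then show "openin (top_of_set G) T \<and> G \<subseteq> closure T"
    proof cases
      case 1
      have "openin (top_of_set G) (rel_interior G)"
        using openin_rel_interior rel_interior_subset openin_subset_trans hull_subset by metis
      then show ?thesis using 1 convex_closure_rel_interior[OF convG] closure_subset by simp
    next
      case 2
      have FS: "F \<subseteq> S" using 2(2) face_of_imp_subset by blast
      have "compact F" using 2(2) S face_of_polytope_polytope polytope_imp_compact by blast
      then have "closed (i ` F)"
        using continuous_on_subset[OF i(1) FS] compact_continuous_image compact_imp_closed by blast
      then have "openin (top_of_set G) T"
        unfolding 2(1) Diff_eq by (intro openin_open_Int) auto
      moreover have "G \<subseteq> closure T"
      proof (rule ccontr)
        assume "\<not> G \<subseteq> closure T"
        then have ne: "G \<inter> - closure T \<noteq> {}" by blast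
        let ?U = "G \<inter> - closure T"
        have U: "?U \<subseteq> i ` F" using 2(1) closure_subset by blast
        have "\<exists>u e. e > 0 \<and> u \<in> G \<and> ball u e \<subseteq> - closure T"
          using ne open_contains_ball[of "- closure T"] by blast
        then obtain u e where u: "e > 0" "u \<in> G" "ball u e \<subseteq> - closure T" by blast
        let ?V = "G \<inter> ball u e"
        have "aff_dim G = aff_dim ?V"
          using u aff_dim_convex_Int_open[OF convG, of "ball u e"] by force
        also have "\<dots> \<le> aff_dim F"
        proof (rule invariance_of_dimension_convex_domain)
          show "convex ?V" using convG by (simp add: convex_Int)
          show "continuous_on ?V i'" using cont_i' GS by (auto intro: continuous_on_subset)
          have sub: "?V \<subseteq> i ` F" using U u by blast
          have "i' y \<in> F \<and> i (i' y) = y" if y: "y \<in> ?V" for y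
          proof -
            obtain x where "x \<in> F" "y = i x" using sub y by blast
            then show ?thesis using i' FS by auto
          qed
          then show "i' \<in> ?V \<rightarrow> affine hull F" "inj_on i' ?V"
            by (auto intro: hull_inc inj_on_inverseI[of _ i])
        qed
        finally show False using 2(3) by simp
      qed
      ultimately show ?thesis by blast
    qed
  qed
  with GP(2) obtain q where q: "q \<in> \<Inter>\<G>" by (metis closure_empty ex_in_conv subset_empty)
  then have qG: "q \<in> rel_interior G"
    and q_avoids: "\<And>F. F face_of S \<Longrightarrow> aff_dim F < aff_dim G \<Longrightarrow> q \<notin> i ` F"
    unfolding \<G>_def by blast+
  have "q \<in> G" using qG rel_interior_subset by blast
  then obtain s where s: "s \<in> S" "i s = q" using GS by blast
  obtain F where F: "F face_of S" "s \<in> rel_interior F"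
    using point_in_rel_interior_of_face[OF S s(1)] .
  have FS: "F \<subseteq> S" using F face_of_imp_subset by blast
  have sF: "s \<in> F" using F(2) rel_interior_subset by blast
  then have kd: "aff_dim F \<ge> aff_dim G" using q_avoids[OF F(1)] s by force
  obtain H where H: "H face_of P" "aff_dim H = aff_dim F + 1" "i ` F \<subseteq> H"
    using uniq[OF F(1)] sF by blast
  have convH: "convex H" using H(1) face_of_imp_convex by blast
  have qH: "q \<in> H" using H(3) sF s by blast
  have GH: "G \<subseteq> H"
    using subset_of_face_of[OF H(1) face_of_imp_subset[OF GP(1)]] qH qG by blast
  have "G \<noteq> H" using kd H(2) by auto
  have GfH: "G face_of H" using GH GP(1) H(1) face_of_face by blast
  have "\<not> H \<subseteq> ?A"
    using max[of H] kd H qH by (auto simp: \<K>_def)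
  then have "\<not> affine hull H \<subseteq> ?A" using hull_subset[of H affine] by blast
  let ?B = "affine hull H \<inter> ?A"
  have qB: "q \<in> ?B" using qH hull_subset[of H affine] GP(3) \<open>q \<in> G\<close> by blast
  have "aff_dim ?B = aff_dim F"
    using aff_dim_affine_Int_hyperplane[of "affine hull H" a b] qB \<open>\<not> affine hull H \<subseteq> ?A\<close> H(2)
    by auto
  have iF: "i ` F \<subseteq> H \<inter> ?A" using H(3) FS i(3) by blast
  let ?T = "i ` rel_interior F"
  \<comment> \<open>\<open>H\<close> is one dimension above \<open>F\<close> and not contained in
    the hyperplane, so \<open>?B\<close> has the dimension of \<open>F\<close>. This equality is
    what lets invariance of domain make \<open>?T\<close> a neighbourhood of \<open>q\<close> in
    \<open>?B\<close>.\<close>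
  have "openin (top_of_set ?B) ?T"
  proof (rule invariance_of_domain_affine_sets)
    show "openin (top_of_set (affine hull F)) (rel_interior F)" by (rule openin_rel_interior)
    show "affine ?B" by (simp add: affine_Int affine_hyperplane)
    show "aff_dim ?B \<le> aff_dim (affine hull F)" using \<open>aff_dim ?B = aff_dim F\<close> by simp
    show "continuous_on (rel_interior F) i" "inj_on i (rel_interior F)"
      using i FS rel_interior_subset[of F] by (meson continuous_on_subset inj_on_subset order_trans)+
    show "i \<in> rel_interior F \<rightarrow> ?B"
      using iF rel_interior_subset[of F] hull_subset[of H affine] by blast
  qed simp
  then obtain e where e: "e > 0" "ball q e \<inter> ?B \<subseteq> ?T"
    using F(2) s unfolding openin_contains_ball by blast
  have TH: "?T \<subseteq> H \<inter> ?A" using iF rel_interior_subset[of F] by blast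
  show False
  proof (cases "H \<inter> ?A \<inter> rel_interior H = {}")
    case False
    then obtain w where w: "w \<in> rel_interior H" "a \<bullet> w = b" by blast
    have wH: "w \<in> H" using w rel_interior_subset by blast
    have "w \<notin> G" using face_of_disjoint_rel_interior[OF GfH \<open>G \<noteq> H\<close>] w by blast
    then have "w \<noteq> q" using \<open>q \<in> G\<close> by blast
    \<comment> \<open>This \<open>t\<close> puts \<open>z\<close> beyond \<open>q\<close> on the
      line from \<open>w\<close>, at distance \<open>e / 2\<close> from \<open>q\<close>, hence
      still in \<open>H\<close>. As \<open>q\<close> is strictly between \<open>w\<close> and
      \<open>z\<close>, the face \<open>G\<close> must contain \<open>w\<close>, although a proper
      face of \<open>H\<close> misses its relative interior.\<close>
    define t where "t = e / (2 * norm (q - w))"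
    have t: "t > 0" using e \<open>w \<noteq> q\<close> by (simp add: t_def)
    define z where "z = q + t *\<^sub>R (q - w)"
    have "dist q z < e"
      using e \<open>w \<noteq> q\<close> by (simp add: z_def t_def dist_norm)
    moreover have "z \<in> ?B"
    proof -
      have "z = (1 + t) *\<^sub>R q + (- t) *\<^sub>R w" by (simp add: z_def algebra_simps)
      moreover have "affine ?B" by (simp add: affine_Int affine_hyperplane)
      moreover have "w \<in> ?B" using wH w hull_subset[of H affine] by blast
      ultimately show ?thesis using mem_affine[of ?B q w "1 + t" "- t"] qB by simp
    qed
    ultimately have "z \<in> ?T" using e(2) by auto
    then have "z \<in> H" using TH by blast
    have "q = (1 - 1 / (1 + t)) *\<^sub>R w + (1 / (1 + t)) *\<^sub>R z"
    proof -
      have "(1 + t) *\<^sub>R q = t *\<^sub>R w + z" by (simp add: z_def algebra_simps)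
      moreover have "q = (1 / (1 + t)) *\<^sub>R ((1 + t) *\<^sub>R q)" using t by simp
      ultimately have "q = (1 / (1 + t)) *\<^sub>R (t *\<^sub>R w + z)" by simp
      moreover have "1 - 1 / (1 + t) = t / (1 + t)" using t by (simp add: field_simps)
      ultimately show ?thesis by (simp add: scaleR_add_right)
    qed
    moreover have "w \<noteq> z"
    proof
      assume "w = z"
      then have "(1 + t) *\<^sub>R (q - w) = 0" by (simp add: z_def algebra_simps)
      then show False using t \<open>w \<noteq> q\<close> by simp
    qed
    ultimately have "q \<in> open_segment w z"
      using t unfolding in_segment by (intro conjI exI[of _ "1 / (1 + t)"]) auto
    then have "w \<in> G"
      using GfH wH \<open>z \<in> H\<close> \<open>q \<in> G\<close> unfolding face_of_def by blast
    then show False using \<open>w \<notin> G\<close> by blast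
  next
    case True
    let ?K = "H \<inter> ?A"
    \<comment> \<open>The connected relative interior of \<open>H\<close> misses the hyperplane and
      so stays on one side; the hyperplane therefore supports \<open>H\<close>.\<close>
    have K: "?K face_of H"
    proof -
      have conn: "connected (rel_interior H)"
        using convH convex_rel_interior convex_connected by blast
      have closure: "H \<subseteq> closure (rel_interior H)"
        using convex_closure_rel_interior[OF convH] closure_subset by blast
      have "(\<forall>x \<in> rel_interior H. a \<bullet> x \<le> b) \<or> (\<forall>x \<in> rel_interior H. a \<bullet> x \<ge> b)"
      proof (rule ccontr)
        assume "\<not> ?thesis"
        then obtain x y where "x \<in> rel_interior H" "y \<in> rel_interior H" "a \<bullet> x \<le> b" "b \<le> a \<bullet> y"
          by force
        from connected_ivt_hyperplane[OF conn this] True rel_interior_subset[of H]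
        show False by blast
      qed
      then consider "H \<subseteq> {x. a \<bullet> x \<le> b}" | "H \<subseteq> {x. a \<bullet> x \<ge> b}"
        using closure closure_minimal[of "rel_interior H" "{x. a \<bullet> x \<le> b}"]
          closure_minimal[of "rel_interior H" "{x. a \<bullet> x \<ge> b}"]
          closed_halfspace_le closed_halfspace_ge by blast
      then show ?thesis
        by cases (use convH in \<open>blast intro: face_of_Int_supporting_hyperplane_le
            face_of_Int_supporting_hyperplane_ge\<close>)+
    qed
    have KP: "?K face_of P" using K H(1) face_of_trans by blast
    have qK: "q \<in> ?K" using qH GP(3) \<open>q \<in> G\<close> by blast
    have "?K \<in> \<K>" using KP qK by (auto simp: \<K>_def)
    then have "aff_dim ?K \<le> aff_dim F" using max[of ?K] kd by simp
    moreover have "aff_dim F \<le> aff_dim ?K"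
    proof (rule invariance_of_dimension_convex_domain)
      show "convex F" using F(1) face_of_imp_convex by blast
      show "continuous_on F i" "inj_on i F" using i FS by (meson continuous_on_subset inj_on_subset)+
      show "i \<in> F \<rightarrow> affine hull ?K" using iF hull_subset[of ?K affine] by blast
    qed
    ultimately have dimK: "aff_dim ?K = aff_dim F" by simp
    have "r \<in> P" using meets interior_subset by blast
    have dimP: "aff_dim P = DIM('a)" using meets(1) aff_dim_nonempty_interior by blast
    \<comment> \<open>Codimension two leaves room for two faces just above \<open>?K\<close>. In
      codimension one, \<open>?K\<close> would span the whole hyperplane and contain the interior
      point \<open>r\<close>, forcing \<open>?K = P\<close>.\<close>
    have "aff_dim ?K + 2 \<le> aff_dim P"
    proof (rule ccontr)
      assume "\<not> ?thesis"
      then have dim: "aff_dim ?K \<ge> DIM('a) - 1" using dimP by simp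
      have "aff_dim ?K \<le> aff_dim ?A" by (intro aff_dim_subset) auto
      then have "aff_dim ?K = aff_dim ?A" using dim a by simp
      moreover have "affine hull ?K \<subseteq> ?A"
        by (simp add: affine_hyperplane hull_minimal)
      ultimately have "affine hull ?K = ?A"
        using qK by (intro affine_dim_equal) (auto simp: affine_hyperplane)
      then have "r \<in> ?K"
        using face_of_imp_eq_affine_Int[OF convP KP] meets \<open>r \<in> P\<close> by blast
      then have "?K = P" using face_of_disjoint_interior[OF KP] meets(1) by blast
      then have "aff_dim P < DIM('a)"
        using \<open>aff_dim ?K = aff_dim ?A\<close> a by simp
      then show False using dimP by simp
    qed
    then obtain H1 H2 where "H1 face_of P" "H2 face_of P" "H1 \<noteq> H2" "?K \<subseteq> H1" "?K \<subseteq> H2"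
      "aff_dim H1 = aff_dim ?K + 1" "aff_dim H2 = aff_dim ?K + 1"
      using face_in_two_faces[OF P KP] qK by blast
    then show False
      using uniq[OF F(1)] sF iF dimK by (metis (no_types, lifting) empty_iff order_trans)
  qed
qed

text \<open>By \<open>no_face\<close> a facet reaching the half-space has a point strictly inside
  it: otherwise its part in the hyperplane would be a nonempty face of \<open>P\<close>. Cutting by
  the open half-space then preserves the dimension of the facet.\<close>

lemma halfspace_facet:
  fixes P :: "'a::euclidean_space set"
  assumes no_face: "\<And>G. G face_of P \<Longrightarrow> G \<subseteq> {x. a \<bullet> x = b} \<Longrightarrow> G = {}"
    and dim: "aff_dim (P \<inter> {x. a \<bullet> x \<le> b}) = aff_dim P"
    and F: "F facet_of P" "F \<inter> {x. a \<bullet> x \<le> b} \<noteq> {}"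
  shows "(F \<inter> {x. a \<bullet> x \<le> b}) facet_of (P \<inter> {x. a \<bullet> x \<le> b})"
    "F \<inter> {x. a \<bullet> x \<le> b} \<noteq> P \<inter> {x. a \<bullet> x = b}"
proof -
  let ?L = "{x. a \<bullet> x \<le> b}"
  have FP: "F face_of P" using F facet_of_imp_face_of by blast
  have convF: "convex F" using FP face_of_imp_convex by blast
  have lt: "\<exists>p \<in> F. a \<bullet> p < b"
  proof (rule ccontr)
    assume "\<not> ?thesis"
    then have ge: "\<And>x. x \<in> F \<Longrightarrow> a \<bullet> x \<ge> b" by force
    then have "(F \<inter> {x. a \<bullet> x = b}) face_of P"
      using face_of_Int_supporting_hyperplane_ge[OF convF] FP face_of_trans by blast
    then have "F \<inter> {x. a \<bullet> x = b} = {}" using no_face by blast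
    then show False using F(2) ge by force
  qed
  then have "aff_dim F = aff_dim (F \<inter> {x. a \<bullet> x < b})"
    using aff_dim_convex_Int_open[OF convF open_halfspace_lt, of a b] by force
  also have "\<dots> \<le> aff_dim (F \<inter> ?L)" by (rule aff_dim_subset) auto
  finally have "aff_dim (F \<inter> ?L) = aff_dim F"
    using aff_dim_subset[of "F \<inter> ?L" F] by simp
  moreover have "(F \<inter> ?L) face_of (P \<inter> ?L)"
    using FP by (intro face_of_slice) (simp_all add: convex_halfspace_le)
  ultimately show "(F \<inter> ?L) facet_of (P \<inter> ?L)"
    using F dim by (auto simp: facet_of_def)
  show "F \<inter> ?L \<noteq> P \<inter> {x. a \<bullet> x = b}" using lt by force
qed

text \<open>Take \<open>g\<close> in the relative interior of \<open>G\<close>: any facet of the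
  truncated polytope through \<open>g\<close> equals \<open>G\<close>. Hence \<open>g\<close> is off
  the slice, so it must lie on the frontier of \<open>P\<close>, and a facet of \<open>P\<close>
  through \<open>g\<close> has trace \<open>G\<close>.\<close>

lemma facet_of_halfspace_Int:
  fixes P :: "'a::euclidean_space set"
  assumes P: "polytope P"
    and no_face: "\<And>G. G face_of P \<Longrightarrow> G \<subseteq> {x. a \<bullet> x = b} \<Longrightarrow> G = {}"
    and dim: "aff_dim P = DIM('a)" "aff_dim (P \<inter> {x. a \<bullet> x \<le> b}) = aff_dim P"
    and slice: "(P \<inter> {x. a \<bullet> x = b}) facet_of (P \<inter> {x. a \<bullet> x \<le> b})"
    and G: "G facet_of (P \<inter> {x. a \<bullet> x \<le> b})" "G \<noteq> P \<inter> {x. a \<bullet> x = b}"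
  obtains F where "F facet_of P" "G = F \<inter> {x. a \<bullet> x \<le> b}"
proof -
  let ?L = "{x. a \<bullet> x \<le> b}"
  let ?P = "P \<inter> ?L"
  have eqI: "C = D" if "C facet_of ?P" "D facet_of ?P" "C \<subseteq> D" for C D
  proof (rule ccontr)
    assume "C \<noteq> D"
    have "C face_of D"
      using that facet_of_imp_face_of face_of_subset facet_of_imp_subset by blast
    moreover have "convex D" using that facet_of_imp_face_of face_of_imp_convex by blast
    ultimately have "aff_dim C < aff_dim D" using face_of_aff_dim_lt \<open>C \<noteq> D\<close> by blast
    then show False using that by (simp add: facet_of_def)
  qed
  have GL: "G face_of ?P" using G facet_of_imp_face_of by blast
  have "G \<noteq> {}" using G by (simp add: facet_of_def)
  then obtain g where g: "g \<in> rel_interior G"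
    using GL face_of_imp_convex rel_interior_eq_empty by blast
  have gG: "g \<in> G" using g rel_interior_subset by blast
  have gP: "g \<in> ?P" using gG GL face_of_imp_subset by blast
  have "G \<noteq> ?P" using G by (metis facet_of_irrefl)
  have absorb: "G = D" if "D facet_of ?P" "g \<in> D" for D
    using eqI[OF G(1) that(1)] subset_of_face_of[OF facet_of_imp_face_of[OF that(1)]
        face_of_imp_subset[OF GL]] that(2) g by blast
  have "a \<bullet> g \<noteq> b" using absorb[OF slice] G(2) gP by blast
  then have "a \<bullet> g < b" using gP by simp
  have "g \<notin> interior P"
  proof
    assume "g \<in> interior P"
    then have "g \<in> interior P \<inter> {x. a \<bullet> x < b}" using \<open>a \<bullet> g < b\<close> by simp
    moreover have "open (interior P \<inter> {x. a \<bullet> x < b})"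
      by (intro open_Int open_interior open_halfspace_lt)
    moreover have "interior P \<inter> {x. a \<bullet> x < b} \<subseteq> ?P" using interior_subset[of P] by auto
    ultimately have "g \<in> interior ?P" using interiorI by metis
    then show False using face_of_disjoint_interior[OF GL \<open>G \<noteq> ?P\<close>] gG by blast
  qed
  moreover have "rel_interior P = interior P"
    using dim by (simp add: aff_dim_eq_full rel_interior_interior)
  ultimately have "g \<in> rel_frontier P"
    using gP closure_subset by (auto simp: rel_frontier_def)
  then obtain F where F: "F facet_of P" "g \<in> F"
    using rel_frontier_of_polyhedron[OF polytope_imp_polyhedron[OF P]] by auto
  have "(F \<inter> ?L) facet_of ?P"
    using halfspace_facet(1)[OF no_face dim(2) F(1)] F(2) gP by blast
  then have "G = F \<inter> ?L" using absorb F(2) gP by blast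
  then show ?thesis using that F(1) by blast
qed

section \<open>Gluing along closed pieces\<close>

text \<open>Agreement of \<open>f\<close> and \<open>g\<close> pastes the forward map only. The
  condition \<open>overlap\<close> makes the two inverses agree on \<open>A' \<inter> B'\<close> and
  keeps points outside \<open>A \<inter> B\<close> from landing there.\<close>

lemma homeomorphic_space_closed_pasting:
  assumes A: "closedin X A" and B: "closedin X B" and AB: "topspace X = A \<union> B"
    and A': "closedin Y A'" and B': "closedin Y B'" and AB': "topspace Y = A' \<union> B'"
    and f: "homeomorphic_maps (subtopology X A) (subtopology Y A') f f'"
    and g: "homeomorphic_maps (subtopology X B) (subtopology Y B') g g'"
    and fg: "\<And>x. x \<in> A \<inter> B \<Longrightarrow> f x = g x"
    and overlap: "A' \<inter> B' \<subseteq> f ` (A \<inter> B)"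
  shows "X homeomorphic_space Y"
proof -
  have top: "topspace (subtopology X A) = A" "topspace (subtopology X B) = B"
    "topspace (subtopology Y A') = A'" "topspace (subtopology Y B') = B'"
    using A B A' B' by (simp_all add: closedin_subset inf.absorb2)
  have cont: "continuous_map (subtopology X A) (subtopology Y A') f"
    "continuous_map (subtopology Y A') (subtopology X A) f'"
    "continuous_map (subtopology X B) (subtopology Y B') g"
    "continuous_map (subtopology Y B') (subtopology X B) g'"
    and inv: "\<And>x. x \<in> A \<Longrightarrow> f' (f x) = x" "\<And>y. y \<in> A' \<Longrightarrow> f (f' y) = y"
    "\<And>x. x \<in> B \<Longrightarrow> g' (g x) = x" "\<And>y. y \<in> B' \<Longrightarrow> g (g' y) = y"
    using f g unfolding homeomorphic_maps_def top by blast+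
  have into: "f x \<in> A'" if "x \<in> A" for x using continuous_map_image_subset_topspace[OF cont(1)] that by (auto simp: top image_subset_iff simp del: topspace_subtopology)
  have into': "f' y \<in> A" if "y \<in> A'" for y using continuous_map_image_subset_topspace[OF cont(2)] that by (auto simp: top image_subset_iff simp del: topspace_subtopology)
  have intog: "g x \<in> B'" if "x \<in> B" for x using continuous_map_image_subset_topspace[OF cont(3)] that by (auto simp: top image_subset_iff simp del: topspace_subtopology)
  have intog': "g' y \<in> B" if "y \<in> B'" for y using continuous_map_image_subset_topspace[OF cont(4)] that by (auto simp: top image_subset_iff simp del: topspace_subtopology)
  have overlap_pt: "\<exists>x \<in> A \<inter> B. y = f x \<and> f' y = x \<and> g' y = x" if y: "y \<in> A' \<inter> B'" for y
  proof -
    obtain x where x: "x \<in> A \<inter> B" "y = f x" using y overlap by blast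
    then have "f' y = x" "g' y = x" using inv(1)[of x] inv(3)[of x] fg[of x] by auto
    then show ?thesis using x by blast
  qed
  have fg': "f' y = g' y" if "y \<in> A' \<inter> B'" for y
    using overlap_pt[OF that] by auto
  have A_reflect: "x \<in> B" if "x \<in> A" "f x \<in> B'" for x
    using overlap_pt[of "f x"] inv(1)[OF that(1)] into[OF that(1)] that(2) by auto
  have B_reflect: "x \<in> A" if "x \<in> B" "g x \<in> A'" for x
    using overlap_pt[of "g x"] inv(3)[OF that(1)] intog[OF that(1)] that(2) by auto
  let ?h = "\<lambda>x. if x \<in> A then f x else g x" and ?k = "\<lambda>y. if y \<in> A' then f' y else g' y"
  have "continuous_map X Y ?h"
  proof (rule pasting_lemma_closed[where I = UNIV and T = "\<lambda>b. if b then A else B"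
        and f = "\<lambda>b. if b then f else g"])
    show "continuous_map (subtopology X (if b then A else B)) Y (if b then f else g)" for b
      using cont by (auto intro: continuous_map_into_fulltopology)
  qed (use A B AB fg in \<open>auto split: if_splits\<close>)
  moreover have "continuous_map Y X ?k"
  proof (rule pasting_lemma_closed[where I = UNIV and T = "\<lambda>b. if b then A' else B'"
        and f = "\<lambda>b. if b then f' else g'"])
    show "continuous_map (subtopology Y (if b then A' else B')) X (if b then f' else g')" for b
      using cont by (auto intro: continuous_map_into_fulltopology)
  qed (use A' B' AB' fg' in \<open>auto split: if_splits\<close>)
  moreover have "?k (?h x) = x" if "x \<in> topspace X" for x
    using that AB inv into intog B_reflect by auto
  moreover have "?h (?k y) = y" if "y \<in> topspace Y" for y
  proof (cases "y \<in> A'")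
    case True
    then show ?thesis using inv(2) into' by simp
  next
    case False
    then have "y \<in> B'" using that AB' by blast
    then show ?thesis using False inv(4) intog'[of y] fg[of "g' y"] into[of "g' y"] by auto
  qed
  ultimately have "homeomorphic_maps X Y ?h ?k" by (auto simp: homeomorphic_maps_def)
  then show ?thesis by (rule homeomorphic_maps_imp_homeomorphic_space)
qed

section \<open>Closed pieces of the quotient space and maps induced on classes\<close>

lemma topspace_colored_manifold: "topspace (colored_manifold P lam) = glue_class P lam ` (P \<times> UNIV)"
  by (simp add: colored_manifold_def topspace_quotient_topology)

text \<open>The underlying set is named apart from \<open>piece_manifold\<close> because pasting
  speaks of closed subsets of one ambient space.\<close>

definition piece :: "'a::euclidean_space set \<Rightarrow> ('a set \<Rightarrow> bit ^ 'n) \<Rightarrow> 'a set \<Rightarrow> ('a \<times> (bit ^ 'n)) set set"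
  where "piece P lam Q = {c \<in> topspace (colored_manifold P lam). proj c \<in> Q}"

lemma piece_eq: "Q \<subseteq> P \<Longrightarrow> piece P lam Q = glue_class P lam ` (Q \<times> UNIV)"
  unfolding piece_def topspace_colored_manifold by (force simp: proj_glue_class)

lemma piece_manifold_eq: "piece_manifold P lam Q = subtopology (colored_manifold P lam) (piece P lam Q)"
  by (simp add: piece_manifold_def piece_def)

lemma closedin_piece:
  fixes lam :: "'a::euclidean_space set \<Rightarrow> bit ^ 'n"
  assumes "closedin (top_of_set P) Q"
  shows "closedin (colored_manifold P lam) (piece P lam Q)"
proof -
  let ?X = "prod_topology (top_of_set P) (discrete_topology (UNIV :: (bit ^ 'n) set))"
  have q: "quotient_map ?X (colored_manifold P lam) (glue_class P lam)"
    unfolding colored_manifold_def by (rule quotient_map_quotient_topology)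
  have "Q \<subseteq> P" using assms closedin_subset by fastforce
  then have "{x \<in> topspace ?X. glue_class P lam x \<in> piece P lam Q} = Q \<times> UNIV"
    by (auto simp: piece_def topspace_colored_manifold proj_glue_class)
  moreover have "closedin ?X (Q \<times> UNIV)"
    using assms by (simp add: closedin_prod_Times_iff)
  moreover have "piece P lam Q \<subseteq> topspace (colored_manifold P lam)" by (auto simp: piece_def)
  ultimately show ?thesis
    using q[unfolded quotient_map_closedin, THEN conjunct2, rule_format, of "piece P lam Q"] by simp
qed

text \<open>The preimage of a piece is closed and saturated, and a quotient map restricted to such a
  set remains one. Maps out of a piece can therefore be tested on \<open>Q\<close> times the
  discrete group.\<close>

lemma quotient_map_piece:
  fixes lam :: "'a::euclidean_space set \<Rightarrow> bit ^ 'n"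
  assumes "closedin (top_of_set P) Q"
  shows "quotient_map (prod_topology (top_of_set Q) (discrete_topology UNIV))
    (piece_manifold P lam Q) (glue_class P lam)"
proof -
  let ?X = "prod_topology (top_of_set P) (discrete_topology (UNIV :: (bit ^ 'n) set))"
  have q: "quotient_map ?X (colored_manifold P lam) (glue_class P lam)"
    unfolding colored_manifold_def by (rule quotient_map_quotient_topology)
  have QP: "Q \<subseteq> P" using assms closedin_subset by fastforce
  then have "{x \<in> topspace ?X. glue_class P lam x \<in> piece P lam Q} = Q \<times> UNIV"
    by (auto simp: piece_def topspace_colored_manifold proj_glue_class)
  from quotient_map_restriction[OF q this] closedin_piece[OF assms, of lam]
  have "quotient_map (subtopology ?X (Q \<times> UNIV)) (piece_manifold P lam Q) (glue_class P lam)"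
    by (simp add: piece_manifold_eq)
  moreover have "subtopology ?X (Q \<times> UNIV) = prod_topology (top_of_set Q) (discrete_topology UNIV)"
    using QP by (simp add: subtopology_Times subtopology_subtopology inf.absorb2)
  ultimately show ?thesis by simp
qed

text \<open>A chain of gluings never leaves the fibre over \<open>p\<close>, so compatibility is
  needed over \<open>p\<close> alone. This pointwise form of \<open>induced_glue_class\<close> suits
  maps such as \<open>g1\<close> that are controlled only on one half of \<open>P\<close>.\<close>

lemma induced_glue_class_at:
  assumes step: "\<And>v F. F facet_of P \<Longrightarrow> p \<in> F \<Longrightarrow> (f (p, v), f (p, v + lam F)) \<in> glue_rel P' lam'"
  shows "induced (glue_rel P' lam') f (glue_class P lam (p, v)) = glue_class P' lam' (f (p, v))"
proof -
  have "fst x = fst y \<and> (fst x = p \<longrightarrow> (f x, f y) \<in> glue_rel P' lam')"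
    if "(x, y) \<in> glue_rel P lam" for x y
    using that
  proof (rule glue_rel_induct, goal_cases)
    case 1 then show ?case by (simp add: glue_rel_refl)
  next
    case 2 then show ?case using step by auto
  next
    case 3 then show ?case by (auto intro: symD[OF sym_glue_rel])
  next
    case 4 then show ?case by (auto intro: transD[OF trans_glue_rel])
  qed
  then have f: "(f (p, v), f y) \<in> glue_rel P' lam'" if "((p, v), y) \<in> glue_rel P lam" for y
    using that by fastforce
  show ?thesis
  proof
    show "induced (glue_rel P' lam') f (glue_class P lam (p, v)) \<subseteq> glue_class P' lam' (f (p, v))"
      unfolding induced_def glue_class_def
      using f transD[OF trans_glue_rel[of P' lam']] by blast
    show "glue_class P' lam' (f (p, v)) \<subseteq> induced (glue_rel P' lam') f (glue_class P lam (p, v))"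
      unfolding induced_def glue_class_def using glue_rel_refl[of "(p, v)" P lam] by blast
  qed
qed

lemma continuous_map_induced:
  fixes lam :: "'a::euclidean_space set \<Rightarrow> bit ^ 'n" and lam' :: "'b::euclidean_space set \<Rightarrow> bit ^ 'n"
  assumes Q: "closedin (top_of_set P) Q" and Q': "Q' \<subseteq> P'"
    and g: "continuous_on Q g" "g ` Q \<subseteq> Q'"
    and h: "\<And>p v. p \<in> Q \<Longrightarrow> h (glue_class P lam (p, v)) = glue_class P' lam' (g p, \<tau> v)"
  shows "continuous_map (piece_manifold P lam Q) (piece_manifold P' lam' Q') h"
proof (rule continuous_compose_quotient_map[OF quotient_map_piece[OF Q]])
  let ?D = "discrete_topology (UNIV :: (bit ^ 'n) set)"
  let ?X = "prod_topology (top_of_set Q) ?D"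
  have q: "continuous_map (prod_topology (top_of_set P') ?D) (colored_manifold P' lam') (glue_class P' lam')"
    unfolding colored_manifold_def using quotient_imp_continuous_map quotient_map_quotient_topology by blast
  have "continuous_map ?X (prod_topology (top_of_set P') ?D) (\<lambda>x. (g (fst x), \<tau> (snd x)))"
  proof (intro continuous_map_pairedI)
    show "continuous_map ?X (top_of_set P') (\<lambda>x. g (fst x))"
      using g Q' continuous_map_compose[OF continuous_map_fst, of "top_of_set Q" "top_of_set P'" g ?D]
      by (auto simp: o_def)
    show "continuous_map ?X ?D (\<lambda>x. \<tau> (snd x))"
      using continuous_map_compose[OF continuous_map_snd, of ?D ?D \<tau> "top_of_set Q"]
      by (simp add: o_def)
  qed
  from continuous_map_compose[OF this q]
  have "continuous_map ?X (colored_manifold P' lam') (h \<circ> glue_class P lam)"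
    by (rule continuous_map_eq) (auto simp: h)
  moreover have "(h \<circ> glue_class P lam) \<in> topspace ?X \<rightarrow> piece P' lam' Q'"
    using g(2) h by (auto simp: piece_eq[OF Q'])
  ultimately show "continuous_map ?X (piece_manifold P' lam' Q') (h \<circ> glue_class P lam)"
    unfolding piece_manifold_eq by (rule continuous_map_into_subtopology)
qed

lemma homeomorphic_maps_induced:
  fixes lam :: "'a::euclidean_space set \<Rightarrow> bit ^ 'n" and lam' :: "'b::euclidean_space set \<Rightarrow> bit ^ 'n"
  assumes Q: "closedin (top_of_set P) Q" and Q': "closedin (top_of_set P') Q'"
    and g: "homeomorphic_maps (top_of_set Q) (top_of_set Q') g g'"
    and \<tau>: "\<And>v. \<tau>' (\<tau> v) = v" "\<And>v. \<tau> (\<tau>' v) = v"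
    and step: "\<And>F p v. F facet_of P \<Longrightarrow> p \<in> F \<Longrightarrow> p \<in> Q \<Longrightarrow>
      ((g p, \<tau> v), (g p, \<tau> (v + lam F))) \<in> glue_rel P' lam'"
    and step': "\<And>F p v. F facet_of P' \<Longrightarrow> p \<in> F \<Longrightarrow> p \<in> Q' \<Longrightarrow>
      ((g' p, \<tau>' v), (g' p, \<tau>' (v + lam' F))) \<in> glue_rel P lam"
  obtains h h' where "homeomorphic_maps (piece_manifold P lam Q) (piece_manifold P' lam' Q') h h'"
    "\<And>p v. p \<in> Q \<Longrightarrow> h (glue_class P lam (p, v)) = glue_class P' lam' (g p, \<tau> v)"
proof -
  let ?h = "induced (glue_rel P' lam') (\<lambda>(p, v). (g p, \<tau> v))"
  let ?h' = "induced (glue_rel P lam) (\<lambda>(p, v). (g' p, \<tau>' v))"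
  have h: "?h (glue_class P lam (p, v)) = glue_class P' lam' (g p, \<tau> v)" if "p \<in> Q" for p v
    by (subst induced_glue_class_at) (use step that in auto)
  have h': "?h' (glue_class P' lam' (p, v)) = glue_class P lam (g' p, \<tau>' v)" if "p \<in> Q'" for p v
    by (subst induced_glue_class_at) (use step' that in auto)
  have sub: "Q \<subseteq> P" "Q' \<subseteq> P'" using Q Q' closedin_subset by fastforce+
  have cont: "continuous_on Q g" "g ` Q \<subseteq> Q'" "continuous_on Q' g'" "g' ` Q' \<subseteq> Q"
    and inv: "\<And>p. p \<in> Q \<Longrightarrow> g' (g p) = p" "\<And>p. p \<in> Q' \<Longrightarrow> g (g' p) = p"
    using g by (auto simp: homeomorphic_maps_def)
  have top: "topspace (piece_manifold P lam Q) = glue_class P lam ` (Q \<times> UNIV)"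
    "topspace (piece_manifold P' lam' Q') = glue_class P' lam' ` (Q' \<times> UNIV)"
    using quotient_map_piece[OF Q, of lam] quotient_map_piece[OF Q', of lam']
    by (simp_all add: quotient_map_def)
  have "homeomorphic_maps (piece_manifold P lam Q) (piece_manifold P' lam' Q') ?h ?h'"
    unfolding homeomorphic_maps_def
  proof (intro conjI ballI)
    show "continuous_map (piece_manifold P lam Q) (piece_manifold P' lam' Q') ?h"
      by (rule continuous_map_induced[OF Q sub(2) cont(1,2) h])
    show "continuous_map (piece_manifold P' lam' Q') (piece_manifold P lam Q) ?h'"
      by (rule continuous_map_induced[OF Q' sub(1) cont(3,4) h'])
    show "?h' (?h c) = c" if c: "c \<in> topspace (piece_manifold P lam Q)" for c
      using c cont(2) unfolding top by (auto simp: h h' inv \<tau> image_subset_iff)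
    show "?h (?h' c) = c" if c: "c \<in> topspace (piece_manifold P' lam' Q')" for c
      using c cont(4) unfolding top by (auto simp: h h' inv \<tau> image_subset_iff)
  qed
  then show ?thesis using that h by blast
qed

section \<open>Facets of the pieces cut out by a sector\<close>

lemma sectorD:
  fixes P :: "(real ^ 'n) set"
  assumes "sector S P i P1 P2"
  shows "polytope S" "polytope P1" "polytope P2"
    "aff_dim P1 = int CARD('n)" "aff_dim P2 = int CARD('n)"
    "P = P1 \<union> P2" "P1 \<inter> P2 = i ` S" "i ` S facet_of P1" "i ` S facet_of P2"
    "embedding_map (top_of_set S) (top_of_set P) i"
    "\<forall>F. F face_of S \<and> F \<noteq> {} \<longrightarrow>
      (\<exists>!H. H face_of P \<and> aff_dim H = aff_dim F + 1 \<and> i ` F \<subseteq> H)"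
  using assms unfolding sector_def simple_polytope_def by - (elim conjE, assumption)+

text \<open>This symmetry lets every result about the first half be applied to the second.\<close>

lemma sector_commute: "sector S P i P1 P2 \<Longrightarrow> sector S P i P2 P1"
  unfolding sector_def
  by (elim conjE, intro conjI; (assumption | simp only: Un_commute Int_commute))

text \<open>Convexity of \<open>P\<close> forces a flat cut, and the uniqueness clause of
  \<open>sector\<close> feeds \<open>hyperplane_slice_no_face\<close>. The last conclusion is the
  form in which the absence of vertices on the sector gets used.\<close>

lemma sector_halfspace:
  fixes P :: "(real ^ 'n) set"
  assumes P: "simple_polytope CARD('n) P" and sec: "sector S P i P1 P2"
  obtains a b where "P1 = P \<inter> {x. a \<bullet> x \<le> b}" "i ` S = P \<inter> {x. a \<bullet> x = b}"
    "\<forall>G. G face_of P \<longrightarrow> G \<subseteq> {x. a \<bullet> x = b} \<longrightarrow> G = {}"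
proof -
  note D = sectorD[OF sec]
  have poly: "polytope P" using P unfolding simple_polytope_def by blast
  have conv: "convex (P1 \<union> P2)" using poly polytope_imp_convex unfolding D(6) by blast
  have dim: "aff_dim P1 = DIM(real ^ 'n)" "aff_dim P2 = DIM(real ^ 'n)" using D(4,5) by simp_all
  have facet: "(P1 \<inter> P2) facet_of P1" "(P1 \<inter> P2) facet_of P2" using D(8,9) unfolding D(7) .
  obtain a b where ab: "a \<noteq> 0" "P1 = (P1 \<union> P2) \<inter> {x. a \<bullet> x \<le> b}"
    "P2 = (P1 \<union> P2) \<inter> {x. a \<bullet> x \<ge> b}" "\<exists>x \<in> interior (P1 \<union> P2). a \<bullet> x = b"
    by (rule convex_union_split[OF D(2,3) conv dim facet])
  note ab = ab[folded D(6)]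
  have "P1 \<inter> P2 = P \<inter> {x. a \<bullet> x = b}" using ab(2,3) by force
  then have slice: "i ` S = P \<inter> {x. a \<bullet> x = b}" using D(7) by simp
  have cont: "continuous_on S i"
    using homeomorphic_imp_continuous_map[OF D(10)[unfolded embedding_map_def]]
    by (simp add: continuous_map_in_subtopology)
  have inj: "inj_on i S"
    using homeomorphic_imp_injective_map[OF D(10)[unfolded embedding_map_def]] by simp
  obtain r where r: "r \<in> interior P" "a \<bullet> r = b" using ab(4) by blast
  have "G = {}" if "G face_of P" "G \<subseteq> {x. a \<bullet> x = b}" for G
    by (rule hyperplane_slice_no_face[OF poly D(1) r ab(1) cont inj slice _ that]) (use D(11) in blast)
  then show ?thesis using that[of a b] ab(2) slice by blast
qed

lemma sector_facet_Int:
  fixes P :: "(real ^ 'n) set"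
  assumes P: "simple_polytope CARD('n) P" and sec: "sector S P i P1 P2"
    and F: "F facet_of P" "F \<inter> P1 \<noteq> {}"
  shows "(F \<inter> P1) facet_of P1" "F \<inter> P1 \<noteq> i ` S"
proof -
  obtain a b where ab: "P1 = P \<inter> {x. a \<bullet> x \<le> b}" "i ` S = P \<inter> {x. a \<bullet> x = b}"
    "\<forall>G. G face_of P \<longrightarrow> G \<subseteq> {x. a \<bullet> x = b} \<longrightarrow> G = {}"
    by (rule sector_halfspace[OF P sec])
  have dim: "aff_dim (P \<inter> {x. a \<bullet> x \<le> b}) = aff_dim P"
    using P sectorD(4)[OF sec] ab(1) unfolding simple_polytope_def by auto
  have eq: "F \<inter> P1 = F \<inter> {x. a \<bullet> x \<le> b}" using F(1) facet_of_imp_subset ab(1) by blast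
  show "(F \<inter> P1) facet_of P1" "F \<inter> P1 \<noteq> i ` S"
    using halfspace_facet[OF ab(3)[rule_format] dim F(1)] F(2) unfolding eq ab(2) by (simp_all add: ab(1))
qed

lemma sector_facet_cases:
  fixes P :: "(real ^ 'n) set"
  assumes P: "simple_polytope CARD('n) P" and sec: "sector S P i P1 P2"
    and G: "G facet_of P1" "G \<noteq> i ` S"
  obtains F where "F facet_of P" "G = F \<inter> P1"
proof -
  obtain a b where ab: "P1 = P \<inter> {x. a \<bullet> x \<le> b}" "i ` S = P \<inter> {x. a \<bullet> x = b}"
    "\<forall>G. G face_of P \<longrightarrow> G \<subseteq> {x. a \<bullet> x = b} \<longrightarrow> G = {}"
    by (rule sector_halfspace[OF P sec])
  have poly: "polytope P" and dim: "aff_dim P = DIM(real ^ 'n)"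
    and dim1: "aff_dim (P \<inter> {x. a \<bullet> x \<le> b}) = aff_dim P"
    using P sectorD(4)[OF sec] ab(1) unfolding simple_polytope_def by auto
  have slice: "(P \<inter> {x. a \<bullet> x = b}) facet_of (P \<inter> {x. a \<bullet> x \<le> b})"
    using sectorD(8)[OF sec] ab(1,2) by simp
  obtain F where F: "F facet_of P" "G = F \<inter> {x. a \<bullet> x \<le> b}"
    using facet_of_halfspace_Int[OF poly ab(3)[rule_format] dim dim1 slice] G ab(1,2) by blast
  then have "G = F \<inter> P1" using facet_of_imp_subset ab(1) by blast
  then show ?thesis using that F(1) by blast
qed

text \<open>The trace of \<open>F\<close> still has codimension one in \<open>P\<close>, so
  \<open>F \<inter> F'\<close> is a face of both facets of the same dimension as each, hence equal
  to both.\<close>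

lemma sector_facet_inject:
  fixes P :: "(real ^ 'n) set"
  assumes P: "simple_polytope CARD('n) P" and sec: "sector S P i P1 P2"
    and F: "F facet_of P" "F \<inter> P1 \<noteq> {}" and F': "F' facet_of P" "F \<inter> P1 \<subseteq> F'"
  shows "F = F'"
proof -
  have dim: "aff_dim P1 = aff_dim P"
    using P sectorD(4)[OF sec] unfolding simple_polytope_def by simp
  have face: "F face_of P" "F' face_of P" using F F' facet_of_imp_face_of by auto
  have dimF: "aff_dim F = aff_dim P - 1" "aff_dim F' = aff_dim P - 1"
    using F F' by (auto simp: facet_of_def)
  have "aff_dim (F \<inter> P1) = aff_dim P - 1"
    using sector_facet_Int(1)[OF P sec F] dim by (simp add: facet_of_def)
  moreover have "aff_dim (F \<inter> P1) \<le> aff_dim (F \<inter> F')" using F' by (intro aff_dim_subset) auto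
  ultimately have ge: "aff_dim (F \<inter> F') \<ge> aff_dim P - 1" by simp
  have eq: "F \<inter> F' = E" if E: "E face_of P" "F \<inter> F' \<subseteq> E" "aff_dim E = aff_dim P - 1" for E
  proof (rule ccontr)
    assume ne: "F \<inter> F' \<noteq> E"
    have "(F \<inter> F') face_of E"
      using face_of_Int[OF face] E face_of_face by blast
    from face_of_aff_dim_lt[OF face_of_imp_convex[OF E(1)] this ne] ge E(3) show False by simp
  qed
  show ?thesis using eq[OF face(1)] eq[OF face(2)] dimF by auto
qed

section \<open>Transport of facets and colours between the halves of the two polytopes\<close>

lemma corner_homeomorphism_inverse:
  assumes g: "corner_homeomorphism P Q g" "homeomorphic_maps (top_of_set P) (top_of_set Q) g g'"
  shows "corner_homeomorphism Q P g'"
  unfolding corner_homeomorphism_def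
proof (intro conjI allI impI)
  have inv: "\<And>x. x \<in> P \<Longrightarrow> g' (g x) = x" "\<And>y. y \<in> Q \<Longrightarrow> g (g' y) = y" "g' ` Q \<subseteq> P"
    using g(2) by (auto simp: homeomorphic_maps_def)
  show "homeomorphic_map (top_of_set Q) (top_of_set P) g'"
    using g(2) homeomorphic_maps_map by blast
  fix F assume F: "F \<subseteq> Q"
  have "g ` g' ` F = F" using inv(2) F by force
  moreover have "g' ` F \<subseteq> P" using inv(3) F by blast
  ultimately show "g' ` F face_of P \<longleftrightarrow> F face_of Q"
    using g(1) unfolding corner_homeomorphism_def by metis
qed

text \<open>A corner homeomorphism taking sector to sector takes the remaining facets, which are the
  traces, to traces; injectivity of traces evaluates the \<open>THE\<close> that defines
  \<open>lam'\<close>. Only the images of the sectors must match, so the twist of \<open>g2\<close>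
  by \<open>\<psi>\<close> is harmless.\<close>

lemma sector_facet_image:
  fixes P P' :: "(real ^ 'n) set"
  assumes P: "simple_polytope CARD('n) P" and sec: "sector S P i P1 P2"
    and P': "simple_polytope CARD('n) P'" and sec': "sector S' P' j P1' P2'"
    and g: "corner_homeomorphism P1 P1' g" "g ` i ` S = j ` S'"
    and F: "F facet_of P" "F \<inter> P1 \<noteq> {}"
  obtains F' where "F' facet_of P'" "g ` (F \<inter> P1) = F' \<inter> P1'"
    "(THE F1. F1 facet_of P \<and> F1 \<inter> P1 \<noteq> {} \<and> g ` (F1 \<inter> P1) \<subseteq> F') = F"
proof -
  have inj: "inj_on g P1"
    using g(1) homeomorphic_imp_injective_map unfolding corner_homeomorphism_def by fastforce
  have onto: "g ` P1 = P1'"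
    using g(1) homeomorphic_imp_surjective_map unfolding corner_homeomorphism_def by fastforce
  have "convex P1" using sectorD(2)[OF sec] by (rule polytope_imp_convex)
  have iS: "i ` S \<subseteq> P1" using sectorD(7)[OF sec] by blast
  note FI = sector_facet_Int[OF P sec F]
  have "g ` (F \<inter> P1) facet_of P1'"
    by (rule corner_homeomorphism_facet[OF g(1) \<open>convex P1\<close> FI(1)])
  moreover have "g ` (F \<inter> P1) \<noteq> j ` S'"
    using FI(2) inj_on_image_eq_iff[OF inj _ iS, of "F \<inter> P1"] g(2) by auto
  ultimately obtain F' where F': "F' facet_of P'" "g ` (F \<inter> P1) = F' \<inter> P1'"
    using sector_facet_cases[OF P' sec'] by blast
  have "(THE F1. F1 facet_of P \<and> F1 \<inter> P1 \<noteq> {} \<and> g ` (F1 \<inter> P1) \<subseteq> F') = F"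
  proof (rule the_equality)
    show "F facet_of P \<and> F \<inter> P1 \<noteq> {} \<and> g ` (F \<inter> P1) \<subseteq> F'" using F F'(2) by blast
  next
    fix F1 assume F1: "F1 facet_of P \<and> F1 \<inter> P1 \<noteq> {} \<and> g ` (F1 \<inter> P1) \<subseteq> F'"
    then have "g ` (F1 \<inter> P1) \<subseteq> g ` (F \<inter> P1)" using F'(2) onto by blast
    then have "F1 \<inter> P1 \<subseteq> F" using inj_on_image_subset_iff[OF inj, of "F1 \<inter> P1" "F \<inter> P1"] by blast
    then show "F1 = F" using sector_facet_inject[OF P sec _ _ F(1)] F1 by blast
  qed
  then show ?thesis using that F' by blast
qed

text \<open>One statement for both halves: \<open>L\<close> is the change of colours and
  \<open>\<tau>\<close> a bijection that turns adding a colour \<open>x\<close> into adding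
  \<open>L x\<close>. The first half takes identities, the second
  \<open>\<rho>\<^sup>-\<^sup>1\<close> with a translation.\<close>

lemma sector_piece_homeomorphism:
  fixes P P' :: "(real ^ 'n) set" and lam lam' :: "(real ^ 'n) set \<Rightarrow> bit ^ 'm"
  assumes P: "simple_polytope CARD('n) P" and sec: "sector S P i P1 P2"
    and P': "simple_polytope CARD('n) P'" and sec': "sector S' P' j P1' P2'"
    and g: "corner_homeomorphism P1 P1' g" "g ` i ` S = j ` S'"
    and lam': "\<And>F. F facet_of P' \<Longrightarrow> F \<inter> P1' \<noteq> {} \<Longrightarrow>
      lam' F = L (lam (THE F1. F1 facet_of P \<and> F1 \<inter> P1 \<noteq> {} \<and> g ` (F1 \<inter> P1) \<subseteq> F))"
    and \<tau>: "\<And>v. \<tau>' (\<tau> v) = v" "\<And>v. \<tau> (\<tau>' v) = v" "\<And>v x. \<tau> (v + x) = \<tau> v + L x"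
  obtains h h' where "homeomorphic_maps (piece_manifold P lam P1) (piece_manifold P' lam' P1') h h'"
    "\<And>p v. p \<in> P1 \<Longrightarrow> h (glue_class P lam (p, v)) = glue_class P' lam' (g p, \<tau> v)"
proof -
  obtain g' where g': "homeomorphic_maps (top_of_set P1) (top_of_set P1') g g'"
    using g(1) unfolding corner_homeomorphism_def homeomorphic_map_maps by blast
  have inv: "\<And>x. x \<in> P1 \<Longrightarrow> g' (g x) = x" "\<And>y. y \<in> P1' \<Longrightarrow> g (g' y) = y"
    and im: "g ` P1 \<subseteq> P1'" "g' ` P1' \<subseteq> P1"
    using g' by (auto simp: homeomorphic_maps_def)
  have iS: "i ` S \<subseteq> P1" using sectorD(7)[OF sec] by blast
  have g'S: "g' ` j ` S' = i ` S"
    unfolding g(2)[symmetric] using inv(1) iS by force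
  have closed: "closedin (top_of_set P) P1" "closedin (top_of_set P') P1'"
    using sectorD(2,6)[OF sec] sectorD(2,6)[OF sec'] polytope_imp_closed
    by (auto intro!: closed_subset)
  show ?thesis
  proof (rule homeomorphic_maps_induced[OF closed g' \<tau>(1,2)])
    fix F p v assume F: "F facet_of P" "p \<in> F" "p \<in> P1"
    then have "F \<inter> P1 \<noteq> {}" by blast
    then obtain F' where F': "F' facet_of P'" "g ` (F \<inter> P1) = F' \<inter> P1'"
      "(THE F1. F1 facet_of P \<and> F1 \<inter> P1 \<noteq> {} \<and> g ` (F1 \<inter> P1) \<subseteq> F') = F"
      using sector_facet_image[OF P sec P' sec' g F(1)] by blast
    have "g p \<in> F' \<inter> P1'" using F F'(2) by blast
    then have "lam' F' = L (lam F)" using lam'[OF F'(1)] unfolding F'(3) by blast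
    then show "((g p, \<tau> v), (g p, \<tau> (v + lam F))) \<in> glue_rel P' lam'"
      using glue_rel_step[OF F'(1), of "g p" "\<tau> v" lam'] \<open>g p \<in> F' \<inter> P1'\<close> \<tau>(3) by simp
  next
    fix F' p v assume F': "F' facet_of P'" "p \<in> F'" "p \<in> P1'"
    then have "F' \<inter> P1' \<noteq> {}" by blast
    then obtain F where F: "F facet_of P" "g' ` (F' \<inter> P1') = F \<inter> P1"
      using sector_facet_image[OF P' sec' P sec corner_homeomorphism_inverse[OF g(1) g'] g'S F'(1)]
      by blast
    have pF: "g' p \<in> F \<inter> P1" using F' F(2) by blast
    then have "F \<inter> P1 \<noteq> {}" by blast
    \<comment> \<open>\<open>F\<close> was found through the inverse of \<open>g\<close>, while the
      formula for \<open>lam'\<close> is phrased with \<open>g\<close>. Going forward again gives a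
      facet \<open>E\<close> for which the \<open>THE\<close> is known to be \<open>F\<close>;
      comparing traces identifies \<open>E\<close> with \<open>F'\<close>.\<close>
    then obtain E where E: "E facet_of P'" "g ` (F \<inter> P1) = E \<inter> P1'"
      "(THE F1. F1 facet_of P \<and> F1 \<inter> P1 \<noteq> {} \<and> g ` (F1 \<inter> P1) \<subseteq> E) = F"
      using sector_facet_image[OF P sec P' sec' g F(1)] by blast
    have "g ` g' ` (F' \<inter> P1') = F' \<inter> P1'" using inv(2) by force
    then have "F' \<inter> P1' = E \<inter> P1'" using F(2) E(2) by simp
    then have "F' = E"
      using sector_facet_inject[OF P' sec' F'(1) \<open>F' \<inter> P1' \<noteq> {}\<close> E(1)] by blast
    then have "lam' F' = L (lam F)" using lam'[OF F'(1) \<open>F' \<inter> P1' \<noteq> {}\<close>] E(3) by simp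
    then have "\<tau>' (v + lam' F') = \<tau>' v + lam F"
      using \<tau>(1)[of "\<tau>' v + lam F"] \<tau>(2,3) by simp
    then show "((g' p, \<tau>' v), (g' p, \<tau>' (v + lam' F'))) \<in> glue_rel P lam"
      using glue_rel_step[OF F(1), of "g' p" "\<tau>' v" lam] pF by simp
  qed (rule that)
qed

section \<open>Pasting the two halves along the sector\<close>

lemma matrix_inv_inverse:
  fixes A :: "'a::semiring_1 ^ 'n ^ 'm"
  assumes "invertible A"
  shows "matrix_inv A ** A = mat 1" "A ** matrix_inv A = mat 1"
  using someI_ex[OF assms[unfolded invertible_def]] unfolding matrix_inv_def by blast+

theorem theorem3p2:
  fixes P P' P1 P2 :: "(real ^ 'n) set"
    and S :: "'b::euclidean_space set"
    and lam lam' :: "(real ^ 'n) set \<Rightarrow> bit ^ 'n"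
    and i :: "'b \<Rightarrow> real ^ 'n"
    and \<psi> :: "'b \<Rightarrow> 'b"
    and \<rho> :: "bit ^ 'n ^ 'n"
    and v0 :: "bit ^ 'n"
  assumes "simple_polytope CARD('n) P" and "coloring P lam"
    and "sector S P i P1 P2"
    and "isomorphism_pair S (derived_coloring P i lam) \<psi> \<rho>"
    and "simple_polytope CARD('n) P'" and "coloring P' lam'"
    and "obtained_by S P lam i P1 P2 \<psi> \<rho> P' lam'"
    and "extendable S P lam i P2 \<psi> \<rho> v0"
  shows "colored_manifold P lam homeomorphic_space colored_manifold P' lam'"
proof -
  note P = assms(1) and sec = assms(3) and iso = assms(4) and P' = assms(5)
  obtain j P1' P2' g1 g2 where sec': "sector S P' j P1' P2'"
    and g1: "corner_homeomorphism P1 P1' g1" and g2: "corner_homeomorphism P2 P2' g2"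
    and g1i: "\<forall>s\<in>S. g1 (i s) = j s" and g2i: "\<forall>s\<in>S. g2 (i (\<psi> s)) = j s"
    and lam1: "\<forall>F. F facet_of P' \<and> F \<inter> P1' \<noteq> {} \<longrightarrow>
      lam' F = lam (THE F1. F1 facet_of P \<and> F1 \<inter> P1 \<noteq> {} \<and> g1 ` (F1 \<inter> P1) \<subseteq> F)"
    and lam2: "\<forall>F. F facet_of P' \<and> F \<inter> P2' \<noteq> {} \<longrightarrow>
      lam' F = matrix_inv \<rho> *v
        lam (THE F2. F2 facet_of P \<and> F2 \<inter> P2 \<noteq> {} \<and> g2 ` (F2 \<inter> P2) \<subseteq> F)"
    using assms(7) unfolding obtained_by_def by (elim exE conjE) (rule that)
  have \<psi>S: "\<psi> ` S = S"
    using iso homeomorphic_imp_surjective_map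
    unfolding isomorphism_pair_def corner_homeomorphism_def by fastforce
  have \<rho>: "matrix_inv \<rho> ** \<rho> = mat 1" "\<rho> ** matrix_inv \<rho> = mat 1"
    using iso matrix_inv_inverse unfolding isomorphism_pair_def by blast+
  have g1S: "g1 ` i ` S = j ` S" using g1i by (force simp: image_image)
  have "g2 ` i ` \<psi> ` S = j ` S" using g2i by (force simp: image_image)
  then have g2S: "g2 ` i ` S = j ` S" by (simp only: \<psi>S)
  have un: "P = P1 \<union> P2" "P' = P1' \<union> P2'" and int: "P1 \<inter> P2 = i ` S" "P1' \<inter> P2' = j ` S"
    and poly: "polytope P1" "polytope P2" "polytope P1'" "polytope P2'" "convex S"
    using sectorD(1-3,6,7)[OF sec] sectorD(2,3,6,7)[OF sec'] polytope_imp_convex[OF sectorD(1)[OF sec]]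
    by - (assumption+)
  obtain h1 h1' where h1: "homeomorphic_maps (piece_manifold P lam P1) (piece_manifold P' lam' P1') h1 h1'"
    and h1c: "\<And>p v. p \<in> P1 \<Longrightarrow> h1 (glue_class P lam (p, v)) = glue_class P' lam' (g1 p, v)"
  proof (rule sector_piece_homeomorphism[OF P sec P' sec' g1 g1S,
        of lam' "\<lambda>x. x" lam "\<lambda>x. x" "\<lambda>x. x"])
    show "lam' F = lam (THE F1. F1 facet_of P \<and> F1 \<inter> P1 \<noteq> {} \<and> g1 ` (F1 \<inter> P1) \<subseteq> F)"
      if "F facet_of P'" "F \<inter> P1' \<noteq> {}" for F
      using lam1 that by blast
  qed (use that in simp_all)
  \<comment> \<open>The inverse of the group part \<open>v \<mapsto> \<rho> *v v + v0\<close> of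
    \<open>\<Psi>\<close>, so that following \<open>\<Phi>\<close> by \<open>h2\<close> restores
    \<open>v\<close> on the sector.\<close>
  let ?\<tau> = "\<lambda>v. matrix_inv \<rho> *v (v - v0)"
  obtain h2 h2' where h2: "homeomorphic_maps (piece_manifold P lam P2) (piece_manifold P' lam' P2') h2 h2'"
    and h2c: "\<And>p v. p \<in> P2 \<Longrightarrow> h2 (glue_class P lam (p, v)) = glue_class P' lam' (g2 p, ?\<tau> v)"
  proof (rule sector_piece_homeomorphism[OF P sector_commute[OF sec] P' sector_commute[OF sec'] g2 g2S,
        of lam' "(*v) (matrix_inv \<rho>)" lam "\<lambda>w. \<rho> *v w + v0" ?\<tau>])
    show "lam' F = matrix_inv \<rho> *v
        lam (THE F2. F2 facet_of P \<and> F2 \<inter> P2 \<noteq> {} \<and> g2 ` (F2 \<inter> P2) \<subseteq> F)"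
      if "F facet_of P'" "F \<inter> P2' \<noteq> {}" for F
      using lam2 that by blast
    show "\<rho> *v ?\<tau> v + v0 = v" "?\<tau> (\<rho> *v v + v0) = v" for v
      by (simp_all add: matrix_vector_mul_assoc \<rho>)
    show "?\<tau> (v + x) = ?\<tau> v + matrix_inv \<rho> *v x" for v x
      by (simp add: algebra_simps)
  qed (rule that)
  obtain \<Phi> where \<Phi>: "homeomorphic_map (piece_manifold P lam P2) (piece_manifold P lam P2) \<Phi>"
    and \<Phi>c: "\<And>x. x \<in> topspace (sector_manifold S P lam i) \<Longrightarrow> \<Phi> (sector_inclusion P lam i x) =
        sector_inclusion P lam i (sector_map S (derived_coloring P i lam) \<psi> \<rho> v0 x)"
    using assms(8) unfolding extendable_def by blast
  obtain \<Phi>' where \<Phi>': "homeomorphic_maps (piece_manifold P lam P2) (piece_manifold P lam P2) \<Phi> \<Phi>'"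
    using \<Phi> unfolding homeomorphic_map_maps by blast
  \<comment> \<open>Extendability is stated on classes of the sector manifold; here it is evaluated
    on representatives.\<close>
  have \<Phi>_sector: "\<Phi> (glue_class P lam (i s, v)) = glue_class P lam (i (\<psi> s), \<rho> *v v + v0)"
    if "s \<in> S" for s v
    using \<Phi>c[of "glue_class S (derived_coloring P i lam) (s, v)"] that
    by (simp add: sector_manifold_def topspace_colored_manifold sector_inclusion_glue_class[OF P sec]
        sector_map_glue_class[OF iso poly(5)])
  let ?M = "piece P lam" and ?M' = "piece P' lam'"
  have cl: "closedin (top_of_set P) P1" "closedin (top_of_set P) P2"
    "closedin (top_of_set P') P1'" "closedin (top_of_set P') P2'"
    using poly polytope_imp_closed un by (auto intro!: closed_subset)
  \<comment> \<open>After \<open>\<Phi>\<close>, the point \<open>i (\<psi> s)\<close> goes under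
    \<open>g2\<close> to \<open>j s\<close> and the group parts cancel, so both sides are the class
    of \<open>(j s, v)\<close>. The same value shows that \<open>h1\<close> covers the whole
    intersection of the target pieces.\<close>
  have glued: "h1 (glue_class P lam (i s, v)) = (h2 \<circ> \<Phi>) (glue_class P lam (i s, v))"
    and h1_sector: "h1 (glue_class P lam (i s, v)) = glue_class P' lam' (j s, v)" if s: "s \<in> S" for s v
  proof -
    have "i s \<in> P1" "i (\<psi> s) \<in> P2" using s \<psi>S int(1) by blast+
    then show "h1 (glue_class P lam (i s, v)) = glue_class P' lam' (j s, v)"
      "h1 (glue_class P lam (i s, v)) = (h2 \<circ> \<Phi>) (glue_class P lam (i s, v))"
      using s by (simp_all add: h1c h2c g1i g2i \<Phi>_sector matrix_vector_mul_assoc \<rho>)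
  qed
  have inter: "?M P1 \<inter> ?M P2 = glue_class P lam ` (i ` S \<times> UNIV)"
    "?M' P1' \<inter> ?M' P2' = glue_class P' lam' ` (j ` S \<times> UNIV)"
  proof -
    have "?M P1 \<inter> ?M P2 = ?M (i ` S)" "?M' P1' \<inter> ?M' P2' = ?M' (j ` S)"
      using int by (auto simp: piece_def)
    moreover have "i ` S \<subseteq> P" "j ` S \<subseteq> P'" using int un by auto
    ultimately show "?M P1 \<inter> ?M P2 = glue_class P lam ` (i ` S \<times> UNIV)"
      "?M' P1' \<inter> ?M' P2' = glue_class P' lam' ` (j ` S \<times> UNIV)"
      by (simp_all add: piece_eq)
  qed
  show ?thesis
  proof (rule homeomorphic_space_closed_pasting)
    show "closedin (colored_manifold P lam) (?M P1)" "closedin (colored_manifold P lam) (?M P2)"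
      "closedin (colored_manifold P' lam') (?M' P1')" "closedin (colored_manifold P' lam') (?M' P2')"
      using cl by (simp_all add: closedin_piece)
    show "topspace (colored_manifold P lam) = ?M P1 \<union> ?M P2"
      "topspace (colored_manifold P' lam') = ?M' P1' \<union> ?M' P2'"
      unfolding topspace_colored_manifold using un by (auto simp: piece_eq)
    show "homeomorphic_maps (subtopology (colored_manifold P lam) (?M P1))
        (subtopology (colored_manifold P' lam') (?M' P1')) h1 h1'"
      using h1 by (simp add: piece_manifold_eq)
    show "homeomorphic_maps (subtopology (colored_manifold P lam) (?M P2))
        (subtopology (colored_manifold P' lam') (?M' P2')) (h2 \<circ> \<Phi>) (\<Phi>' \<circ> h2')"
      using homeomorphic_maps_compose[OF conjI[OF \<Phi>' h2]] by (simp add: piece_manifold_eq)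
    show "h1 x = (h2 \<circ> \<Phi>) x" if "x \<in> ?M P1 \<inter> ?M P2" for x
      using that glued unfolding inter by blast
    show "?M' P1' \<inter> ?M' P2' \<subseteq> h1 ` (?M P1 \<inter> ?M P2)"
      unfolding inter using h1_sector by (auto intro!: rev_image_eqI)
  qed
qed

end
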